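(* Assume $z_n<\infty$ for at least one $n\ge1$. Define $n_1=\min\{n\colon z_n<\infty\}$ and recursively $n_{i+1}=\min\{n\colon n>n_i,\ z_n<z_{n-1}\}$, and let $z_0=\inf\{z_{n_i}\colon i\geq 1\}$. Then $z_0=z_{n_j}$ for some $j$, the form $\langle\cdot,\cdot\rangle_{\kappa}$ is positive-definite on $\mathcal{P}_\tau$ for $0\le\kappa<z_0$, and $z_0$ is a singular value.
   Context: $R\subset\mathbb{R}^{N}$ is a reduced root system, $W$ the finite reflection group generated by the reflections $\sigma_v\colon x\mapsto x-2\frac{\langle x,v\rangle}{\langle v,v\rangle}v$, $v\in R$, with positive roots $R_+$; $W$ has a single conjugacy class of reflections and $\kappa$ is a real constant parameter. $\tau$ is an irreducible orthogonal representation of $W$ on a finite-dimensional real space $V$ with basis $\{u_i\}$ and $W$-invariant inner product $\langle\cdot,\cdot\rangle_V$. $\mathcal{P}_n$ is the space of homogeneous polynomials of degree $n$ in $x=(x_1,\dots,x_N)$, $\mathcal{P}_{\tau}=\mathcal{P}\otimes V$ with $W$-action $w(p(x)\otimes u)=p(xw)\otimes\tau(w)u$. Dunkl operators: $\mathcal{D}_i(p\otimes u)=\frac{\partial p}{\partial x_i}\otimes u+\kappa\sum_{v\in R_+}\frac{p(x)-p(x\sigma_v)}{\langle x,v\rangle}v_i\otimes\tau(\sigma_v)u$. The form $\langle\cdot,\cdot\rangle_{\kappa}$ is the unique bilinear symmetric form on $\mathcal{P}_\tau$ with $\langle 1\otimes u_1,1\otimes u_2\rangle_{\kappa}=\langle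 u_1,u_2\rangle_V$, $W$-invariance, orthogonality of homogeneous components of different degrees, and $\langle\mathcal{D}_if,g\rangle_{\kappa}=\langle f,x_ig\rangle_{\kappa}$. For $n\ge1$ consider the Gram matrix of $\langle\cdot,\cdot\rangle_{\kappa}$ restricted to $\mathcal{P}_n\otimes V$ in the basis $\{x^\alpha\otimes u_i\colon |\alpha|=n\}$; its leading principal minors are polynomials in $\kappa$, positive near $\kappa=0$. $z_n$ is the smallest positive zero of any of these minors, or $\infty$ if none exists. A singular value is a value of $\kappa$ for which there is a nonconstant $f\in\mathcal{P}_\tau$ with $\mathcal{D}_if=0$ for all $i$. *)

theory Defs
  imports "HOL-Analysis.Analysis" "HOL-Library.Extended_Real"
begin

text \<open>Vectors of R^N are elements of real^'n (N = CARD('n)); they are row vectors,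
  and the group W is a set of N x N matrices acting on the right: x w = x v* w.\<close>

definition refl_mat :: "real^'n \<Rightarrow> real^'n^'n" where
  "refl_mat v = mat 1 - (2 / (v \<bullet> v)) *\<^sub>R (\<chi> i j. v$i * v$j)"

definition reduced_root_system :: "(real^'n) set \<Rightarrow> bool" where
  "reduced_root_system R \<longleftrightarrow> finite R \<and> 0 \<notin> R
     \<and> (\<forall>v\<in>R. (\<lambda>x. x v* refl_mat v) ` R = R)
     \<and> (\<forall>v\<in>R. \<forall>c::real. c *\<^sub>R v \<in> R \<longrightarrow> c = 1 \<or> c = -1)"

definition positive_roots :: "(real^'n) set \<Rightarrow> (real^'n) set \<Rightarrow> bool" where
  "positive_roots R Rp \<longleftrightarrow>
     (\<exists>b. (\<forall>v\<in>R. v \<bullet> b \<noteq> 0) \<and> Rp = {v\<in>R. v \<bullet> b > 0})"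

text \<open>The group generated by the reflections (finite, so the generated monoid is the group).\<close>
inductive_set reflgroup :: "(real^'n) set \<Rightarrow> (real^'n^'n) set" for R where
  one: "mat 1 \<in> reflgroup R"
| step: "v \<in> R \<Longrightarrow> w \<in> reflgroup R \<Longrightarrow> refl_mat v ** w \<in> reflgroup R"

definition single_refl_class :: "(real^'n) set \<Rightarrow> bool" where
  "single_refl_class R \<longleftrightarrow>
     (\<forall>v\<in>R. \<forall>v'\<in>R. \<exists>w\<in>reflgroup R. w ** refl_mat v = refl_mat v' ** w)"

text \<open>Irreducible orthogonal representation of W on V (V = 'v with its inner product,
  which is the W-invariant inner product).\<close>
definition orth_irrep :: "(real^'n) set \<Rightarrow> (real^'n^'n \<Rightarrow> 'v::euclidean_space \<Rightarrow> 'v) \<Rightarrow> bool" where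
  "orth_irrep R \<tau> \<longleftrightarrow>
     (\<forall>w\<in>reflgroup R. linear (\<tau> w) \<and> (\<forall>a b. \<tau> w a \<bullet> \<tau> w b = a \<bullet> b))
     \<and> (\<forall>w1\<in>reflgroup R. \<forall>w2\<in>reflgroup R. \<tau> (w1 ** w2) = \<tau> w1 \<circ> \<tau> w2)
     \<and> (\<forall>U. subspace U \<and> (\<forall>w\<in>reflgroup R. \<tau> w ` U \<subseteq> U) \<longrightarrow> U = {0} \<or> U = UNIV)"

definition vbasis :: "'v::euclidean_space list \<Rightarrow> bool" where
  "vbasis us \<longleftrightarrow> distinct us \<and> independent (set us) \<and> span (set us) = UNIV"

section \<open>Vector-valued polynomials P_tau = P \<otimes> V, as polynomial functions R^N \<rightarrow> V\<close>

definition monomial :: "('n::finite \<Rightarrow> nat) \<Rightarrow> real^'n \<Rightarrow> real" where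
  "monomial \<alpha> x = (\<Prod>i\<in>UNIV. (x$i) ^ (\<alpha> i))"

definition mdeg :: "('n::finite \<Rightarrow> nat) \<Rightarrow> nat" where
  "mdeg \<alpha> = (\<Sum>i\<in>UNIV. \<alpha> i)"

definition mono :: "('n::finite \<Rightarrow> nat) \<times> 'v::real_vector \<Rightarrow> real^'n \<Rightarrow> 'v" where
  "mono p = (\<lambda>x. monomial (fst p) x *\<^sub>R snd p)"

definition Ptau :: "(real^'n::finite \<Rightarrow> 'v::real_vector) set" where
  "Ptau = {f. \<exists>c::('n \<Rightarrow> nat) \<Rightarrow> 'v. finite {\<alpha>. c \<alpha> \<noteq> 0}
              \<and> f = (\<lambda>x. \<Sum>\<alpha>\<in>{\<alpha>. c \<alpha> \<noteq> 0}. monomial \<alpha> x *\<^sub>R c \<alpha>)}"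

definition Phom :: "nat \<Rightarrow> (real^'n::finite \<Rightarrow> 'v::real_vector) set" where
  "Phom n = {f. \<exists>c::('n \<Rightarrow> nat) \<Rightarrow> 'v. finite {\<alpha>. c \<alpha> \<noteq> 0}
              \<and> (\<forall>\<alpha>. c \<alpha> \<noteq> 0 \<longrightarrow> mdeg \<alpha> = n)
              \<and> f = (\<lambda>x. \<Sum>\<alpha>\<in>{\<alpha>. c \<alpha> \<noteq> 0}. monomial \<alpha> x *\<^sub>R c \<alpha>)}"

definition partial :: "'n \<Rightarrow> (real^'n \<Rightarrow> 'v::real_normed_vector) \<Rightarrow> real^'n \<Rightarrow> 'v" where
  "partial i f x = vector_derivative (\<lambda>t. f (x + t *\<^sub>R axis i 1)) (at 0)"

text \<open>The divided difference (p(x) - p(x sigma_v)) / <x,v>, which is again a polynomial;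
  as a function it is the unique polynomial function agreeing with the quotient
  off the hyperplane <x,v> = 0.\<close>
definition ddiff :: "real^'n::finite \<Rightarrow> (real^'n \<Rightarrow> 'v::real_vector) \<Rightarrow> real^'n \<Rightarrow> 'v" where
  "ddiff v f = (THE g. g \<in> Ptau \<and>
      (\<forall>x. x \<bullet> v \<noteq> 0 \<longrightarrow> g x = (1 / (x \<bullet> v)) *\<^sub>R (f x - f (x v* refl_mat v))))"

definition Dunkl :: "(real^'n) set \<Rightarrow> (real^'n^'n \<Rightarrow> 'v \<Rightarrow> 'v) \<Rightarrow> real \<Rightarrow> 'n::finite
                      \<Rightarrow> (real^'n \<Rightarrow> 'v::euclidean_space) \<Rightarrow> real^'n \<Rightarrow> 'v" where
  "Dunkl Rp \<tau> \<kappa> i f = (\<lambda>x. partial i f x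
       + \<kappa> *\<^sub>R (\<Sum>v\<in>Rp. (v$i) *\<^sub>R \<tau> (refl_mat v) (ddiff v f x)))"

definition Wact :: "(real^'n^'n \<Rightarrow> 'v \<Rightarrow> 'v) \<Rightarrow> real^'n^'n \<Rightarrow> (real^'n::finite \<Rightarrow> 'v) \<Rightarrow> real^'n \<Rightarrow> 'v" where
  "Wact \<tau> w f = (\<lambda>x. \<tau> w (f (x v* w)))"

definition is_kform :: "(real^'n) set \<Rightarrow> (real^'n) set \<Rightarrow> (real^'n^'n \<Rightarrow> 'v \<Rightarrow> 'v) \<Rightarrow> real
     \<Rightarrow> ((real^'n::finite \<Rightarrow> 'v::euclidean_space) \<Rightarrow> (real^'n \<Rightarrow> 'v) \<Rightarrow> real) \<Rightarrow> bool" where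
  "is_kform R Rp \<tau> \<kappa> B \<longleftrightarrow>
     (\<forall>f1\<in>Ptau. \<forall>f2\<in>Ptau. \<forall>g\<in>Ptau. \<forall>a b.
        B (\<lambda>x. a *\<^sub>R f1 x + b *\<^sub>R f2 x) g = a * B f1 g + b * B f2 g)
   \<and> (\<forall>f\<in>Ptau. \<forall>g\<in>Ptau. B f g = B g f)
   \<and> (\<forall>u1 u2. B (\<lambda>x. u1) (\<lambda>x. u2) = u1 \<bullet> u2)
   \<and> (\<forall>w\<in>reflgroup R. \<forall>f\<in>Ptau. \<forall>g\<in>Ptau. B (Wact \<tau> w f) (Wact \<tau> w g) = B f g)
   \<and> (\<forall>m n f g. m \<noteq> n \<and> f \<in> Phom m \<and> g \<in> Phom n \<longrightarrow> B f g = 0)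
   \<and> (\<forall>i. \<forall>f\<in>Ptau. \<forall>g\<in>Ptau. B (Dunkl Rp \<tau> \<kappa> i f) g = B f (\<lambda>x. (x$i) *\<^sub>R g x))"

text \<open>The unique such form (normalised to 0 outside P_tau so that it is unique as a HOL function).\<close>
definition kform :: "(real^'n) set \<Rightarrow> (real^'n) set \<Rightarrow> (real^'n^'n \<Rightarrow> 'v \<Rightarrow> 'v) \<Rightarrow> real
     \<Rightarrow> (real^'n::finite \<Rightarrow> 'v::euclidean_space) \<Rightarrow> (real^'n \<Rightarrow> 'v) \<Rightarrow> real" where
  "kform R Rp \<tau> \<kappa> = (THE B. is_kform R Rp \<tau> \<kappa> B
       \<and> (\<forall>f g. \<not> (f \<in> Ptau \<and> g \<in> Ptau) \<longrightarrow> B f g = 0))"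

definition lead_minor :: "(nat \<Rightarrow> nat \<Rightarrow> real) \<Rightarrow> nat \<Rightarrow> real" where
  "lead_minor M m = (\<Sum>p | p permutes {..<m}. of_int (sign p) * (\<Prod>i<m. M i (p i)))"

text \<open>ord n is the chosen ordering of the basis {x^alpha \<otimes> u_i : |alpha| = n}.\<close>
definition gram :: "(real^'n) set \<Rightarrow> (real^'n) set \<Rightarrow> (real^'n^'n \<Rightarrow> 'v \<Rightarrow> 'v) \<Rightarrow> real
     \<Rightarrow> (nat \<Rightarrow> (('n::finite \<Rightarrow> nat) \<times> 'v::euclidean_space) list) \<Rightarrow> nat \<Rightarrow> nat \<Rightarrow> nat \<Rightarrow> real" where
  "gram R Rp \<tau> \<kappa> ord n j k = kform R Rp \<tau> \<kappa> (mono (ord n ! j)) (mono (ord n ! k))"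

definition zval :: "(real^'n) set \<Rightarrow> (real^'n) set \<Rightarrow> (real^'n^'n \<Rightarrow> 'v \<Rightarrow> 'v)
     \<Rightarrow> (nat \<Rightarrow> (('n::finite \<Rightarrow> nat) \<times> 'v::euclidean_space) list) \<Rightarrow> nat \<Rightarrow> ereal" where
  "zval R Rp \<tau> ord n = (INF \<kappa> \<in> {\<kappa>. 0 < \<kappa> \<and>
       (\<exists>m\<in>{1..length (ord n)}. lead_minor (gram R Rp \<tau> \<kappa> ord n) m = 0)}. ereal \<kappa>)"

text \<open>The sequence n_1, n_2, ...; nseq z i is Some n_{i+1}, or None once the sequence stops.\<close>
primrec nseq :: "(nat \<Rightarrow> ereal) \<Rightarrow> nat \<Rightarrow> nat option" where
  "nseq z 0 = Some (LEAST n. 1 \<le> n \<and> z n < \<infinity>)"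
| "nseq z (Suc i) = (case nseq z i of None \<Rightarrow> None
     | Some m \<Rightarrow> if (\<exists>n. m < n \<and> z n < z (n - 1))
                 then Some (LEAST n. m < n \<and> z n < z (n - 1)) else None)"

definition singular_value :: "(real^'n) set \<Rightarrow> (real^'n^'n \<Rightarrow> 'v \<Rightarrow> 'v) \<Rightarrow> real
     \<Rightarrow> ('n::finite itself) \<Rightarrow> ('v::euclidean_space itself) \<Rightarrow> bool" where
  "singular_value Rp \<tau> \<kappa> _ _ \<longleftrightarrow>
     (\<exists>f::real^'n \<Rightarrow> 'v. f \<in> Ptau \<and> (\<nexists>u. f = (\<lambda>x. u)) \<and> (\<forall>i. Dunkl Rp \<tau> \<kappa> i f = (\<lambda>x. 0)))"

end

theory Submission
  imports Defs "Jordan_Normal_Form.Determinant"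
begin

text \<open>The Dunkl operators satisfy \<open>D\<^sub>y x\<^sub>z = x\<^sub>z D\<^sub>y + \<langle>y, z\<rangle> + \<kappa> \<Sum>\<^sub>v c\<^sub>v(y, z) s\<^sub>v\<close> with \<open>c\<^sub>v\<close> symmetric in \<open>y\<close> and
  \<open>z\<close>, are equivariant under reflections, and therefore commute. Hence
  \<open>\<langle>x\<^sup>\<alpha> u, g\<rangle> = \<langle>u, (D\<^sup>\<alpha> g)(0)\<rangle>\<close> defines the form for every \<open>\<kappa>\<close>, and its values are continuous in \<open>\<kappa>\<close>.

  At \<open>\<kappa> = 0\<close> the form is positive definite, so on degree \<open>n\<close> it stays so until it first degenerates,
  which happens exactly at \<open>z\<^sub>n\<close>. Multiplying a radical vector by a coordinate gives a radical vector of
  the next degree, so \<open>z\<^sub>n\<close> is nonincreasing. If \<open>z\<^sub>n < z\<^sub>n\<^sub>-\<^sub>1\<close>, then Dunkl operators send a radical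
  vector of degree \<open>n\<close> at \<open>\<kappa> = z\<^sub>n\<close> into the radical in degree \<open>n - 1\<close>, which is zero; so this vector is
  singular. Euler's identity \<open>\<Sum>\<^sub>i x\<^sub>i D\<^sub>i f = n f + \<kappa> \<Sum>\<^sub>v (\<tau>(\<sigma>\<^sub>v) f - s\<^sub>v f)\<close>, evaluated where \<open>|f|\<close> is maximal on
  a sphere, shows that a singular \<open>f\<close> of degree \<open>n\<close> has \<open>n \<le> 2 |\<kappa>| |R\<^sub>+|\<close>. As \<open>z\<^sub>n\<close> is bounded, it drops
  only finitely often and the infimum is attained.\<close>

section \<open>Quadratic forms and leading minors\<close>

no_notation Matrix.vec_index (infixl "$" 100)
hide_type (open) Matrix.vec
hide_const (open) Matrix.mat Matrix.vec
hide_fact (open) Matrix.vec_eq_iff Matrix.mat_def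

definition qform :: "nat \<Rightarrow> (nat \<Rightarrow> nat \<Rightarrow> real) \<Rightarrow> (nat \<Rightarrow> real) \<Rightarrow> (nat \<Rightarrow> real) \<Rightarrow> real" where
  "qform L M x y = (\<Sum>j<L. \<Sum>k<L. x j * y k * M j k)"

text \<open>The sum in \<open>lead_minor\<close> is the Leibniz expansion of the determinant of the
  upper left \<open>m\<close> by \<open>m\<close> corner, and a square matrix is singular exactly
  when it has a nonzero kernel vector. For \<open>m = 0\<close> neither side holds.\<close>

lemma lead_minor_eq_0_iff:
  "lead_minor M m = 0 \<longleftrightarrow> (\<exists>x. (\<exists>i<m. x i \<noteq> 0) \<and> (\<forall>i<m. (\<Sum>j<m. M i j * x j) = 0))"
proof -
  define A where "A = Matrix.mat m m (\<lambda>(i, j). M i j)"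
  have A: "A \<in> carrier_mat m m" by (simp add: A_def)
  have entry: "A $$ (i, p i) = M i (p i)" if "p permutes {0..<m}" "i < m" for p i
    using permutes_in_image[OF that(1), of i] that(2) by (simp add: A_def)
  have "lead_minor M m = Determinant.det A"
    unfolding lead_minor_def det_def'[OF A] lessThan_atLeast0
    by (intro sum.cong refl arg_cong2[where f = "(*)"] prod.cong) (auto simp: entry)
  also have "\<dots> = 0 \<longleftrightarrow> (\<exists>v. v \<in> carrier_vec m \<and> v \<noteq> 0\<^sub>v m \<and> A *\<^sub>v v = 0\<^sub>v m)"
    by (rule det_0_iff_vec_prod_zero[OF A])
  also have "\<dots> \<longleftrightarrow> (\<exists>x. (\<exists>i<m. x i \<noteq> 0) \<and> (\<forall>i<m. (\<Sum>j<m. M i j * x j) = 0))"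
  proof
    assume "\<exists>v. v \<in> carrier_vec m \<and> v \<noteq> 0\<^sub>v m \<and> A *\<^sub>v v = 0\<^sub>v m"
    then obtain v where v: "v \<in> carrier_vec m" "v \<noteq> 0\<^sub>v m" "A *\<^sub>v v = 0\<^sub>v m" by blast
    have "\<exists>i<m. vec_index v i \<noteq> 0" using v(1,2) by (auto simp: Matrix.vec_eq_iff)
    moreover have "(\<Sum>j<m. M i j * vec_index v j) = 0" if "i < m" for i
      using arg_cong[OF v(3), of "\<lambda>w. vec_index w i"] that v(1)
      by (simp add: A_def scalar_prod_def lessThan_atLeast0)
    ultimately show "\<exists>x. (\<exists>i<m. x i \<noteq> 0) \<and> (\<forall>i<m. (\<Sum>j<m. M i j * x j) = 0)" by blast
  next
    assume "\<exists>x. (\<exists>i<m. x i \<noteq> 0) \<and> (\<forall>i<m. (\<Sum>j<m. M i j * x j) = 0)"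
    then obtain x where x: "\<exists>i<m. x i \<noteq> 0" "\<And>i. i < m \<Longrightarrow> (\<Sum>j<m. M i j * x j) = 0" by blast
    define v where "v = Matrix.vec m x"
    have "v \<in> carrier_vec m" "v \<noteq> 0\<^sub>v m" using x(1) by (auto simp: v_def Matrix.vec_eq_iff)
    moreover have "A *\<^sub>v v = 0\<^sub>v m"
      using x(2) by (auto simp: Matrix.vec_eq_iff A_def v_def scalar_prod_def lessThan_atLeast0)
    ultimately show "\<exists>v. v \<in> carrier_vec m \<and> v \<noteq> 0\<^sub>v m \<and> A *\<^sub>v v = 0\<^sub>v m" by blast
  qed
  finally show ?thesis .
qed

lemma qform_eq: "qform L M x y = (\<Sum>k<L. y k * (\<Sum>j<L. x j * M j k))"
  unfolding qform_def by (subst sum.swap) (simp add: sum_distrib_left mult_ac)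

lemma qform_add_scaled:
  assumes "\<And>j k. j < L \<Longrightarrow> k < L \<Longrightarrow> M j k = M k j"
  shows "qform L M (\<lambda>i. x i + t * y i) (\<lambda>i. x i + t * y i)
    = qform L M x x + 2 * t * qform L M x y + t\<^sup>2 * qform L M y y"
proof -
  have "qform L M y x = qform L M x y"
    unfolding qform_def by (subst sum.swap) (auto intro!: sum.cong simp: assms mult_ac)
  moreover have "qform L M (\<lambda>i. x i + t * y i) (\<lambda>i. x i + t * y i)
    = qform L M x x + t * qform L M x y + t * qform L M y x + t\<^sup>2 * qform L M y y"
    by (simp add: qform_def algebra_simps sum.distrib sum_distrib_left power2_eq_square)
  ultimately show ?thesis by simp
qed

text \<open>If \<open>b\<close>, the value at \<open>x\<close> and \<open>y\<close>, were nonzero,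
  the value of the form at \<open>x + t y\<close> would be \<open>2 t b + t^2 c\<close>, which is
  negative for small \<open>t\<close> of sign opposite to \<open>b\<close>.\<close>

lemma qform_null_vector:
  assumes sym: "\<And>j k. j < L \<Longrightarrow> k < L \<Longrightarrow> M j k = M k j"
    and psd: "\<And>y. qform L M y y \<ge> 0" and null: "qform L M x x = 0"
  shows "qform L M x y = 0"
proof (rule ccontr)
  define b where "b = qform L M x y"
  define c where "c = qform L M y y"
  assume "qform L M x y \<noteq> 0"
  then have b: "b \<noteq> 0" by (simp add: b_def)
  have c: "c \<ge> 0" by (simp add: c_def psd)
  \<comment> \<open>The denominator \<open>c + 1\<close> instead of \<open>c\<close> keeps the
    choice valid when \<open>c = 0\<close>.\<close>
  define t where "t = - b / (c + 1)"
  have "0 \<le> 2 * t * b + t\<^sup>2 * c"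
    using psd[of "\<lambda>i. x i + t * y i"] qform_add_scaled[of L M x t y, OF sym] null
    by (simp add: b_def c_def)
  also have "2 * t * b + t\<^sup>2 * c = - (b\<^sup>2 * (c + 2)) / (c + 1)\<^sup>2"
  proof -
    obtain d where d: "c = d - 1" by (metis add_diff_cancel_right')
    with c have "d \<noteq> 0" by auto
    then show ?thesis by (simp add: t_def d field_simps power2_eq_square)
  qed
  also have "\<dots> < 0" using b c by (simp add: divide_neg_pos)
  finally show False by simp
qed

text \<open>The unit sphere of \<open>R^L\<close>. Its vectors are encoded as sequences that vanish
  from \<open>L\<close> on, which places it inside a product space.\<close>

definition usphere :: "nat \<Rightarrow> (nat \<Rightarrow> real) set" where
  "usphere L = {x. (\<forall>i\<ge>L. x i = 0) \<and> (\<Sum>i<L. (x i)\<^sup>2) = 1}"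

text \<open>It is a closed subset of a product of compact intervals whose factors from
  \<open>L\<close> on are \<open>{0}\<close>, so Tychonoff's theorem applies.\<close>

lemma compact_usphere: "compact (usphere L)"
proof -
  let ?S = "\<lambda>i. if i < L then {-1..1} else {0::real}"
  have "compactin (product_topology (\<lambda>_. euclideanreal) (UNIV :: nat set)) (PiE UNIV ?S)"
    unfolding compactin_PiE by auto
  then have "compact (PiE (UNIV :: nat set) ?S)"
    by (simp add: euclidean_product_topology)
  moreover have "closed (usphere L)"
  proof -
    have "usphere L = (\<Inter>i\<in>{L..}. {x. x i = 0}) \<inter> {x. (\<Sum>i<L. (x i)\<^sup>2) = 1}"
      by (auto simp: usphere_def)
    also have "closed \<dots>"
      by (intro closed_Int closed_INT closed_Collect_eq ballI continuous_intros
          continuous_on_product_coordinates)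
    finally show ?thesis .
  qed
  moreover have "usphere L \<subseteq> PiE UNIV ?S"
  proof
    fix x assume x: "x \<in> usphere L"
    have "\<bar>x i\<bar> \<le> 1" if "i < L" for i
    proof -
      have "(x i)\<^sup>2 \<le> (\<Sum>i<L. (x i)\<^sup>2)"
        by (rule member_le_sum) (use that in auto)
      then show ?thesis using x by (simp add: usphere_def abs_square_le_1)
    qed
    then show "x \<in> PiE UNIV ?S" using x by (fastforce simp: usphere_def abs_le_iff)
  qed
  ultimately show ?thesis by (metis compact_Int_closed inf.absorb_iff2)
qed

text \<open>The form is homogeneous of degree two, so its sign can be tested on the compact sphere;
  \<open>c\<close> is the squared length of \<open>x\<close>.\<close>

lemma qform_normalize:
  assumes "i < L" "x i \<noteq> 0"
  obtains y c where "y \<in> usphere L" "c > 0" "qform L M x x = c * qform L M y y"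
proof -
  define r where "r = sqrt (\<Sum>i<L. (x i)\<^sup>2)"
  have "0 < (\<Sum>i<L. (x i)\<^sup>2)"
    by (rule sum_pos2[of _ i]) (use assms in auto)
  then have r: "r > 0" "r\<^sup>2 = (\<Sum>i<L. (x i)\<^sup>2)" by (auto simp: r_def)
  define y where "y = (\<lambda>i. if i < L then x i / r else 0)"
  have "(\<Sum>i<L. (y i)\<^sup>2) = (\<Sum>i<L. (x i)\<^sup>2) / r\<^sup>2"
    by (simp add: y_def power_divide sum_divide_distrib)
  also have "\<dots> = 1" using r by (metis divide_self_if less_numeral_extra(3) zero_less_power)
  finally have "y \<in> usphere L" by (simp add: usphere_def) (simp add: y_def)
  moreover have "qform L M x x = r\<^sup>2 * qform L M y y"
    using r(1) by (simp add: qform_def y_def sum_distrib_left power2_eq_square)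
  ultimately show ?thesis using that r(1) by (metis zero_less_power)
qed

text \<open>Among the pairs of a parameter and a unit vector with nonpositive value of the form, which make
  up a compact set, take one with the least parameter: there the form is positive semidefinite with
  a null vector, hence degenerate.\<close>

lemma pos_def_along_path:
  fixes M :: "real \<Rightarrow> nat \<Rightarrow> nat \<Rightarrow> real"
  assumes cont: "\<And>j k. j < L \<Longrightarrow> k < L \<Longrightarrow> continuous_on UNIV (\<lambda>\<kappa>. M \<kappa> j k)"
    and sym: "\<And>\<kappa> j k. j < L \<Longrightarrow> k < L \<Longrightarrow> M \<kappa> j k = M \<kappa> k j"
    and pd0: "\<And>x i. i < L \<Longrightarrow> x i \<noteq> 0 \<Longrightarrow> qform L (M 0) x x > 0"
    and nondeg: "\<And>\<kappa> x i. 0 < \<kappa> \<Longrightarrow> \<kappa> \<le> s \<Longrightarrow> i < L \<Longrightarrow> x i \<noteq> 0 \<Longrightarrow>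
        \<exists>k<L. (\<Sum>j<L. x j * M \<kappa> j k) \<noteq> 0"
    and s: "0 \<le> s" and x: "i < L" "x i \<noteq> 0"
  shows "qform L (M s) x x > 0"
proof (rule ccontr)
  assume neg: "\<not> qform L (M s) x x > 0"
  define T where "T = {p \<in> {0..s} \<times> usphere L. qform L (M (fst p)) (snd p) (snd p) \<le> 0}"
  obtain y c where y: "y \<in> usphere L" "c > 0" "qform L (M s) x x = c * qform L (M s) y y"
    using qform_normalize[of i L x, OF x] by blast
  with neg s have "(s, y) \<in> T" by (auto simp: T_def not_less mult_le_0_iff)
  have "T \<noteq> {}" using \<open>(s, y) \<in> T\<close> by auto
  have contM: "continuous_on UNIV (\<lambda>p::real \<times> (nat \<Rightarrow> real). M (fst p) j k)" if "j < L" "k < L" for j k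
    by (rule continuous_on_compose2[OF cont[OF that]]) (auto intro: continuous_intros)
  have contx: "continuous_on UNIV (\<lambda>p::real \<times> (nat \<Rightarrow> real). snd p j)" for j
    by (rule continuous_on_product_then_coordinatewise[OF continuous_on_snd[OF continuous_on_id]])
  have "closed {p::real \<times> (nat \<Rightarrow> real). qform L (M (fst p)) (snd p) (snd p) \<le> 0}"
    unfolding qform_def
    by (intro closed_Collect_le continuous_intros contM contx) auto
  from compact_Int_closed[OF compact_Times[OF compact_Icc[of 0 s] compact_usphere[of L]] this]
  have "compact T" unfolding T_def by (simp add: Collect_conj_eq)
  then obtain p where p: "p \<in> T" "\<And>q. q \<in> T \<Longrightarrow> fst p \<le> fst q"
    using continuous_attains_inf[OF _ \<open>T \<noteq> {}\<close> continuous_on_fst[OF continuous_on_id]] by blast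
  obtain \<kappa> z where \<kappa>z: "p = (\<kappa>, z)" by (cases p)
  have z: "z \<in> usphere L" "0 \<le> \<kappa>" "\<kappa> \<le> s" "qform L (M \<kappa>) z z \<le> 0"
    using p(1) by (auto simp: T_def \<kappa>z)
  have "\<exists>i<L. z i \<noteq> 0"
  proof (rule ccontr)
    assume "\<not> (\<exists>i<L. z i \<noteq> 0)"
    then have "(\<Sum>i<L. (z i)\<^sup>2) = 0" by simp
    with z(1) show False by (simp add: usphere_def)
  qed
  then obtain i0 where i0: "i0 < L" "z i0 \<noteq> 0" by blast
  \<comment> \<open>Definiteness at \<open>0\<close> makes the least parameter strictly positive, so
    it can be approached from the left.\<close>
  have "\<kappa> \<noteq> 0" using pd0[where x = z, OF i0] z(4) by auto
  with z(2) have \<kappa>: "\<kappa> > 0" by simp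
  have less: "0 \<le> qform L (M \<mu>) v v" if "0 \<le> \<mu>" "\<mu> < \<kappa>" for \<mu> v
  proof (rule ccontr)
    assume n: "\<not> 0 \<le> qform L (M \<mu>) v v"
    have "\<exists>i<L. v i \<noteq> 0"
    proof (rule ccontr)
      assume "\<not> (\<exists>i<L. v i \<noteq> 0)"
      then have "qform L (M \<mu>) v v = 0" by (simp add: qform_def)
      with n show False by simp
    qed
    then obtain i1 where "i1 < L" "v i1 \<noteq> 0" by blast
    from qform_normalize[of i1 L v "M \<mu>", OF this] obtain w c where
      w: "w \<in> usphere L" "c > 0" "qform L (M \<mu>) v v = c * qform L (M \<mu>) w w" by blast
    with n that z(3) have "(\<mu>, w) \<in> T"
      by (auto simp: T_def not_le mult_less_0_iff)
    with p(2) that(2) show False by (fastforce simp: \<kappa>z)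
  qed
  \<comment> \<open>By minimality no smaller parameter gives a negative value, and the limit from
    the left keeps the inequality.\<close>
  have psd: "0 \<le> qform L (M \<kappa>) v v" for v
  proof -
    have "continuous_on UNIV (\<lambda>\<mu>. qform L (M \<mu>) v v)"
      unfolding qform_def by (intro continuous_intros cont) auto
    then have "((\<lambda>\<mu>. qform L (M \<mu>) v v) \<longlongrightarrow> qform L (M \<kappa>) v v) (at_left \<kappa>)"
      by (simp add: continuous_on_eq_continuous_at continuous_at filterlim_at_split)
    moreover have "eventually (\<lambda>\<mu>. 0 \<le> qform L (M \<mu>) v v) (at_left \<kappa>)"
      using eventually_at_left_real[OF \<kappa>] by eventually_elim (auto intro: less)
    ultimately show ?thesis
      by (rule tendsto_lowerbound) simp
  qed
  have "qform L (M \<kappa>) z z = 0" using psd[of z] z(4) by simp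
  then have null: "qform L (M \<kappa>) z v = 0" for v
    using qform_null_vector[of L "M \<kappa>" z v] sym psd by blast
  obtain k where k: "k < L" "(\<Sum>j<L. z j * M \<kappa> j k) \<noteq> 0"
    using nondeg[where x = z, OF \<kappa> z(3) i0] by blast
  \<comment> \<open>Pairing with the unit vector at \<open>k\<close> extracts the entry that
    nondegeneracy makes nonzero.\<close>
  have "qform L (M \<kappa>) z (\<lambda>i. if i = k then 1 else 0) = (\<Sum>j<L. z j * M \<kappa> j k)"
    using k(1) by (simp add: qform_eq if_distrib[of "\<lambda>x. x * _"] cong: if_cong)
  with null k(2) show False by simp
qed

section \<open>Vector-valued polynomials\<close>

text \<open>A general linear form takes the place of the coordinate function, because reflections
  carry linear forms to linear forms but need not permute the coordinates.\<close>

definition mulX :: "real^'n \<Rightarrow> (real^'n::finite \<Rightarrow> 'v::real_vector) \<Rightarrow> real^'n \<Rightarrow> 'v" where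
  "mulX z f = (\<lambda>x. (x \<bullet> z) *\<^sub>R f x)"

lemma mulX_apply: "mulX z f x = (x \<bullet> z) *\<^sub>R f x"
  by (simp add: mulX_def)

lemma mulX_axis: "mulX (axis i 1) f = (\<lambda>x. (x$i) *\<^sub>R f x)"
  by (simp add: mulX_def inner_axis)

lemma mulX_expand: "mulX z f x = (\<Sum>i\<in>UNIV. z$i *\<^sub>R mulX (axis i 1) f x)"
  unfolding mulX_axis by (simp add: mulX_def inner_vec_def scaleR_sum_left mult.commute)

lemma monomial_Suc: "monomial (\<alpha>(i := Suc (\<alpha> i))) x = x$i * monomial \<alpha> x"
proof -
  have "monomial (\<alpha>(i := Suc (\<alpha> i))) x = (\<Prod>j\<in>UNIV. (if j = i then x$i else 1) * (x$j) ^ \<alpha> j)"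
    unfolding monomial_def by (intro prod.cong) auto
  then show ?thesis by (simp add: prod.distrib monomial_def)
qed

lemma mdeg_Suc: "mdeg (\<alpha>(i := Suc (\<alpha> i))) = Suc (mdeg \<alpha>)"
proof -
  have "mdeg (\<alpha>(i := Suc (\<alpha> i))) = (\<Sum>j\<in>UNIV. (if j = i then 1 else 0) + \<alpha> j)"
    unfolding mdeg_def by (intro sum.cong) auto
  then show ?thesis by (simp add: sum.distrib mdeg_def)
qed

lemma mdeg_0_iff: "mdeg \<alpha> = 0 \<longleftrightarrow> \<alpha> = (\<lambda>_. 0)"
  by (auto simp: mdeg_def)

lemma mdeg_SucE:
  assumes "mdeg \<alpha> = Suc n"
  obtains i \<beta> where "\<alpha> = \<beta>(i := Suc (\<beta> i))" "mdeg \<beta> = n"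
proof -
  have "\<exists>i. \<alpha> i \<noteq> 0" using assms by (metis mdeg_0_iff ext nat.distinct(1))
  then obtain i where i: "\<alpha> i \<noteq> 0" by blast
  define \<beta> where "\<beta> = \<alpha>(i := \<alpha> i - 1)"
  have "\<alpha> = \<beta>(i := Suc (\<beta> i))" using i by (auto simp: \<beta>_def)
  moreover from this have "mdeg \<beta> = n" using assms by (metis mdeg_Suc nat.inject)
  ultimately show ?thesis by (rule that)
qed

text \<open>Polynomials whose monomials have degrees in a prescribed set; this treats
  all polynomials and the homogeneous ones at the same time.\<close>

definition pol :: "nat set \<Rightarrow> (real^'n::finite \<Rightarrow> 'v::real_vector) set" where
  "pol S = {f. \<exists>A c. finite A \<and> (\<forall>\<alpha>\<in>A. mdeg \<alpha> \<in> S)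
              \<and> f = (\<lambda>x. \<Sum>\<alpha>\<in>A. monomial \<alpha> x *\<^sub>R c \<alpha>)}"

lemma pol_sum_monomials:
  "finite A \<Longrightarrow> (\<And>\<alpha>. \<alpha> \<in> A \<Longrightarrow> mdeg \<alpha> \<in> S) \<Longrightarrow> (\<lambda>x. \<Sum>\<alpha>\<in>A. monomial \<alpha> x *\<^sub>R c \<alpha>) \<in> pol S"
  unfolding pol_def by blast

text \<open>\<open>pol\<close> admits any finite index set, possibly with zero coefficients, which
  makes closure under sums easy. Cutting down to the support recovers the shape used by
  \<open>Ptau\<close> and \<open>Phom\<close>.\<close>

lemma pol_support:
  "f \<in> pol S \<longleftrightarrow> (\<exists>c. finite {\<alpha>. c \<alpha> \<noteq> 0} \<and> (\<forall>\<alpha>. c \<alpha> \<noteq> 0 \<longrightarrow> mdeg \<alpha> \<in> S)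
              \<and> f = (\<lambda>x. \<Sum>\<alpha>\<in>{\<alpha>. c \<alpha> \<noteq> 0}. monomial \<alpha> x *\<^sub>R c \<alpha>))"
proof
  assume "f \<in> pol S"
  then obtain A c where A: "finite A" "\<forall>\<alpha>\<in>A. mdeg \<alpha> \<in> S"
    and f: "f = (\<lambda>x. \<Sum>\<alpha>\<in>A. monomial \<alpha> x *\<^sub>R c \<alpha>)" unfolding pol_def by blast
  define d where "d \<alpha> = (if \<alpha> \<in> A then c \<alpha> else 0)" for \<alpha>
  have sub: "{\<alpha>. d \<alpha> \<noteq> 0} \<subseteq> A" by (auto simp: d_def)
  have "f = (\<lambda>x. \<Sum>\<alpha>\<in>{\<alpha>. d \<alpha> \<noteq> 0}. monomial \<alpha> x *\<^sub>R d \<alpha>)"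
    unfolding f by (rule ext, rule sum.mono_neutral_cong_right[OF A(1) sub]) (auto simp: d_def)
  moreover have "finite {\<alpha>. d \<alpha> \<noteq> 0}" using A(1) sub finite_subset by blast
  moreover have "\<forall>\<alpha>. d \<alpha> \<noteq> 0 \<longrightarrow> mdeg \<alpha> \<in> S" using A(2) by (simp add: d_def)
  ultimately show "\<exists>c. finite {\<alpha>. c \<alpha> \<noteq> 0} \<and> (\<forall>\<alpha>. c \<alpha> \<noteq> 0 \<longrightarrow> mdeg \<alpha> \<in> S)
              \<and> f = (\<lambda>x. \<Sum>\<alpha>\<in>{\<alpha>. c \<alpha> \<noteq> 0}. monomial \<alpha> x *\<^sub>R c \<alpha>)" by blast
next
  assume "\<exists>c. finite {\<alpha>. c \<alpha> \<noteq> 0} \<and> (\<forall>\<alpha>. c \<alpha> \<noteq> 0 \<longrightarrow> mdeg \<alpha> \<in> S)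
              \<and> f = (\<lambda>x. \<Sum>\<alpha>\<in>{\<alpha>. c \<alpha> \<noteq> 0}. monomial \<alpha> x *\<^sub>R c \<alpha>)"
  then show "f \<in> pol S" using pol_sum_monomials by blast
qed

lemma Ptau_eq_pol: "Ptau = pol UNIV"
  by (auto simp: pol_support Ptau_def)

lemma Phom_eq_pol: "Phom n = pol {n}"
  by (auto simp: pol_support Phom_def)

lemma pol_mono: "S \<subseteq> T \<Longrightarrow> pol S \<subseteq> pol T"
  unfolding pol_def by blast

lemma Phom_Ptau: "f \<in> Phom n \<Longrightarrow> f \<in> Ptau"
  unfolding Ptau_eq_pol Phom_eq_pol using pol_mono by blast

lemma pol_zero: "(\<lambda>x. 0) \<in> pol S"
  using pol_sum_monomials[of "{}" S] by simp

lemma pol_add: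
  assumes "f \<in> pol S" "g \<in> pol S"
  shows "(\<lambda>x. f x + g x) \<in> pol S"
proof -
  obtain A c where A: "finite A" "\<forall>\<alpha>\<in>A. mdeg \<alpha> \<in> S"
    and f: "f = (\<lambda>x. \<Sum>\<alpha>\<in>A. monomial \<alpha> x *\<^sub>R c \<alpha>)" using assms(1) unfolding pol_def by blast
  obtain B d where B: "finite B" "\<forall>\<alpha>\<in>B. mdeg \<alpha> \<in> S"
    and g: "g = (\<lambda>x. \<Sum>\<alpha>\<in>B. monomial \<alpha> x *\<^sub>R d \<alpha>)" using assms(2) unfolding pol_def by blast
  have "f x = (\<Sum>\<alpha>\<in>A \<union> B. monomial \<alpha> x *\<^sub>R (if \<alpha> \<in> A then c \<alpha> else 0))" for x
    unfolding f by (rule sum.mono_neutral_cong_left) (use A B in auto)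
  moreover have "g x = (\<Sum>\<alpha>\<in>A \<union> B. monomial \<alpha> x *\<^sub>R (if \<alpha> \<in> B then d \<alpha> else 0))" for x
    unfolding g by (rule sum.mono_neutral_cong_left) (use A B in auto)
  ultimately have "(\<lambda>x. f x + g x) = (\<lambda>x. \<Sum>\<alpha>\<in>A \<union> B. monomial \<alpha> x *\<^sub>R
      ((if \<alpha> \<in> A then c \<alpha> else 0) + (if \<alpha> \<in> B then d \<alpha> else 0)))"
    by (simp add: sum.distrib scaleR_add_right)
  also have "\<dots> \<in> pol S" by (rule pol_sum_monomials) (use A B in auto)
  finally show ?thesis .
qed

lemma pol_linear:
  assumes "f \<in> pol S" "linear h"
  shows "(\<lambda>x. h (f x)) \<in> pol S"
proof -
  obtain A c where A: "finite A" "\<forall>\<alpha>\<in>A. mdeg \<alpha> \<in> S"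
    and f: "f = (\<lambda>x. \<Sum>\<alpha>\<in>A. monomial \<alpha> x *\<^sub>R c \<alpha>)" using assms(1) unfolding pol_def by blast
  have "(\<lambda>x. h (f x)) = (\<lambda>x. \<Sum>\<alpha>\<in>A. monomial \<alpha> x *\<^sub>R h (c \<alpha>))"
    using assms(2) by (simp add: f linear_sum linear_scale)
  also have "\<dots> \<in> pol S" by (rule pol_sum_monomials) (use A in auto)
  finally show ?thesis .
qed

lemma pol_scaleR: "f \<in> pol S \<Longrightarrow> (\<lambda>x. a *\<^sub>R f x) \<in> pol S"
  using pol_linear[of f S "\<lambda>y. a *\<^sub>R y"] by (simp add: linear_scaleR)

lemma pol_sum: "(\<And>i. i \<in> I \<Longrightarrow> f i \<in> pol S) \<Longrightarrow> (\<lambda>x. \<Sum>i\<in>I. f i x) \<in> pol S"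
  by (induction I rule: infinite_finite_induct) (auto intro: pol_zero pol_add)

lemma pol_mulX:
  assumes "f \<in> pol S" "Suc ` S \<subseteq> T"
  shows "mulX z f \<in> pol T"
proof -
  obtain A c where A: "finite A" "\<forall>\<alpha>\<in>A. mdeg \<alpha> \<in> S"
    and f: "f = (\<lambda>x. \<Sum>\<alpha>\<in>A. monomial \<alpha> x *\<^sub>R c \<alpha>)" using assms(1) unfolding pol_def by blast
  have "mulX z f = (\<lambda>x. \<Sum>i\<in>UNIV. \<Sum>\<alpha>\<in>A. z$i *\<^sub>R (monomial (\<alpha>(i := Suc (\<alpha> i))) x *\<^sub>R c \<alpha>))"
    by (rule ext, subst mulX_expand)
      (simp add: mulX_axis f monomial_Suc scaleR_sum_right mult_ac)
  also have "\<dots> \<in> pol T"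
  proof (intro pol_sum pol_scaleR)
    fix i \<alpha> assume "\<alpha> \<in> A"
    then show "(\<lambda>x. monomial (\<alpha>(i := Suc (\<alpha> i))) x *\<^sub>R c \<alpha>) \<in> pol T"
      using pol_sum_monomials[of "{\<alpha>(i := Suc (\<alpha> i))}" T "\<lambda>_. c \<alpha>"] A assms(2)
      by (auto simp: mdeg_Suc)
  qed
  finally show ?thesis .
qed

lemma pol_const: "0 \<in> S \<Longrightarrow> (\<lambda>x. u) \<in> pol S"
  using pol_sum_monomials[of "{\<lambda>_. 0}" S "\<lambda>_. u"] by (simp add: monomial_def mdeg_def)

lemmas Ptau_const [intro] = pol_const[of UNIV, folded Ptau_eq_pol, simplified]
lemmas Ptau_zero [intro] = pol_zero[of UNIV, folded Ptau_eq_pol]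
lemmas Ptau_add [intro] = pol_add[of _ UNIV, folded Ptau_eq_pol]
lemmas Ptau_scaleR [intro] = pol_scaleR[of _ UNIV, folded Ptau_eq_pol]
lemmas Ptau_sum [intro] = pol_sum[of _ _ UNIV, folded Ptau_eq_pol]
lemmas Ptau_linear = pol_linear[of _ UNIV, folded Ptau_eq_pol]
lemmas Ptau_mulX [intro] = pol_mulX[of _ UNIV UNIV, folded Ptau_eq_pol, simplified]
lemmas Phom_const = pol_const[of "{0}", folded Phom_eq_pol, simplified]
lemmas Phom_zero = pol_zero[of "{n}" for n, folded Phom_eq_pol]
lemmas Phom_add = pol_add[of _ "{n}" for n, folded Phom_eq_pol]
lemmas Phom_scaleR = pol_scaleR[of _ "{n}" for n, folded Phom_eq_pol]
lemmas Phom_sum = pol_sum[of _ _ "{n}" for n, folded Phom_eq_pol]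
lemmas Phom_linear = pol_linear[of _ "{n}" for n, folded Phom_eq_pol]
lemmas Phom_mulX = pol_mulX[of _ "{n}" "{Suc n}" for n, folded Phom_eq_pol, simplified]

lemma mono_Phom: "mono (\<alpha>, u) \<in> Phom (mdeg \<alpha>)"
  using pol_sum_monomials[of "{\<alpha>}" "{mdeg \<alpha>}" "\<lambda>_. u"] by (simp add: mono_def Phom_eq_pol)

lemma mono_Suc: "mono (\<alpha>(i := Suc (\<alpha> i)), u) = mulX (axis i 1) (mono (\<alpha>, u))"
  by (simp add: mono_def mulX_axis monomial_Suc)

lemma mono_0: "mono (\<lambda>_. 0, u) = (\<lambda>x. u)"
  by (simp add: mono_def monomial_def)

lemma PtauE:
  assumes "f \<in> Ptau"
  obtains A c where "finite A" "f = (\<lambda>x. \<Sum>\<alpha>\<in>A. mono (\<alpha>, c \<alpha>) x)"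
  using assms unfolding Ptau_eq_pol pol_def mono_def by auto

lemma PhomE:
  assumes "f \<in> Phom n"
  obtains A c where "finite A" "\<And>\<alpha>. \<alpha> \<in> A \<Longrightarrow> mdeg \<alpha> = n" "f = (\<lambda>x. \<Sum>\<alpha>\<in>A. mono (\<alpha>, c \<alpha>) x)"
  using assms unfolding Phom_eq_pol pol_def mono_def by auto

text \<open>Constants generate all polynomials under sums and products with linear forms, since a
  monomial is reached by raising one exponent at a time. Facts about an operator thus reduce to its
  behaviour with respect to \<open>mulX\<close>.\<close>

lemma Phom_induct [consumes 1, case_names const add mulX]:
  fixes f :: "real^'n::finite \<Rightarrow> 'v::real_vector"
  assumes f: "f \<in> Phom n"
    and const: "\<And>u. P 0 (\<lambda>x. u)"
    and add: "\<And>n f g. f \<in> Phom n \<Longrightarrow> g \<in> Phom n \<Longrightarrow> P n f \<Longrightarrow> P n g \<Longrightarrow> P n (\<lambda>x. f x + g x)"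
    and mulX: "\<And>n z f. f \<in> Phom n \<Longrightarrow> P n f \<Longrightarrow> P (Suc n) (mulX z f)"
  shows "P n f"
proof -
  have mono: "P (mdeg \<alpha>) (mono (\<alpha>, u))" for \<alpha> u
  proof (induction "mdeg \<alpha>" arbitrary: \<alpha>)
    case 0
    then have "\<alpha> = (\<lambda>_. 0)" by (metis mdeg_0_iff)
    then show ?case using const[of u] 0 by (simp add: mono_0)
  next
    case (Suc m)
    from Suc(2)[symmetric] obtain i \<beta> where b: "\<alpha> = \<beta>(i := Suc (\<beta> i))" "mdeg \<beta> = m"
      by (rule mdeg_SucE)
    then have "P m (mono (\<beta>, u))" using Suc(1) by blast
    then show ?case using mulX[of "mono (\<beta>, u)" m "axis i 1"] mono_Phom[of \<beta> u]
      by (simp add: b mono_Suc mdeg_Suc)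
  qed
  \<comment> \<open>The empty sum counts as homogeneous of every degree; multiplying zero by a
    linear form climbs up from degree \<open>0\<close>.\<close>
  have zero: "P m (\<lambda>x. 0)" for m
  proof (induction m)
    case (Suc m)
    then show ?case using mulX[OF Phom_zero Suc, of undefined] by (simp add: mulX_def)
  qed (rule const)
  obtain A c where A: "finite A" "\<And>\<alpha>. \<alpha> \<in> A \<Longrightarrow> mdeg \<alpha> = n"
    and f: "f = (\<lambda>x. \<Sum>\<alpha>\<in>A. mono (\<alpha>, c \<alpha>) x)" using assms(1) by (rule PhomE) blast
  from A have "P n (\<lambda>x. \<Sum>\<alpha>\<in>A. mono (\<alpha>, c \<alpha>) x) \<and> (\<lambda>x. \<Sum>\<alpha>\<in>A. mono (\<alpha>, c \<alpha>) x) \<in> Phom n"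
  proof (induction A)
    case (insert \<alpha> A)
    then show ?case using mono[of \<alpha> "c \<alpha>"] mono_Phom[of \<alpha> "c \<alpha>"]
      by (auto intro!: add Phom_add)
  qed (auto simp: zero Phom_zero)
  then show ?thesis by (simp add: f)
qed

lemma Ptau_sum_Phom:
  assumes "f \<in> Ptau"
  obtains d h where "\<And>n. h n \<in> Phom n" "f = (\<lambda>x. \<Sum>n<d. h n x)"
proof -
  obtain A c where A: "finite A" "f = (\<lambda>x. \<Sum>\<alpha>\<in>A. mono (\<alpha>, c \<alpha>) x)"
    using assms by (rule PtauE)
  define h where "h n x = (\<Sum>\<alpha>\<in>{\<alpha>\<in>A. mdeg \<alpha> = n}. mono (\<alpha>, c \<alpha>) x)" for n x
  have "h n \<in> Phom n" for n
    unfolding h_def using mono_Phom by (intro Phom_sum) blast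
  moreover have "f = (\<lambda>x. \<Sum>n<Suc (Max (mdeg ` A)). h n x)"
    unfolding A h_def using A(1)
    by (intro ext sum.group[symmetric]) (auto simp: less_Suc_eq_le)
  ultimately show ?thesis by (rule that)
qed

lemma Ptau_induct [consumes 1, case_names const add mulX]:
  fixes f :: "real^'n::finite \<Rightarrow> 'v::real_vector"
  assumes f: "f \<in> Ptau"
    and const: "\<And>u. P (\<lambda>x. u)"
    and add: "\<And>f g. f \<in> Ptau \<Longrightarrow> g \<in> Ptau \<Longrightarrow> P f \<Longrightarrow> P g \<Longrightarrow> P (\<lambda>x. f x + g x)"
    and mulX: "\<And>z f. f \<in> Ptau \<Longrightarrow> P f \<Longrightarrow> P (mulX z f)"
  shows "P f"
proof -
  obtain d h where h: "\<And>n. h n \<in> Phom n" and f: "f = (\<lambda>x. \<Sum>n<d. h n x)"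
    using f by (rule Ptau_sum_Phom) blast
  have "P (h n)" for n
    using h[of n] by (induction rule: Phom_induct) (auto intro: const add mulX Phom_Ptau)
  then have "P (\<lambda>x. \<Sum>n<d. h n x)"
    by (induction d) (auto intro!: const add Phom_Ptau[OF h])
  then show ?thesis by (simp add: f)
qed

section \<open>Substitutions, continuity and partial derivatives of polynomials\<close>

lemma inner_vector_matrix: "((x::real^'n) v* w) \<bullet> z = x \<bullet> (w *v z)"
  by (rule dot_lmul_matrix)

lemma mulX_compose: "mulX z f (x v* w) = mulX (w *v z) (\<lambda>x. f (x v* w)) x"
  by (simp add: mulX_def inner_vector_matrix)

lemma Phom_compose: "f \<in> Phom n \<Longrightarrow> (\<lambda>x. f (x v* w)) \<in> Phom n"
  by (induction rule: Phom_induct) (auto simp: Phom_const mulX_compose intro: Phom_add Phom_mulX)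

lemma Ptau_compose: "f \<in> Ptau \<Longrightarrow> (\<lambda>x. f (x v* w)) \<in> Ptau"
  by (induction rule: Ptau_induct) (auto simp: mulX_compose)

lemma Ptau_continuous: "f \<in> Ptau \<Longrightarrow> continuous_on UNIV (f :: real^'n::finite \<Rightarrow> 'v::real_normed_vector)"
  by (induction rule: Ptau_induct) (auto intro!: continuous_intros simp: mulX_def)

text \<open>\<open>partial\<close> is defined through \<open>vector_derivative\<close>, whose value
  is meaningful only once differentiability along the axis is known.\<close>

lemma Ptau_has_partial:
  fixes f :: "real^'n::finite \<Rightarrow> 'v::real_normed_vector"
  assumes "f \<in> Ptau"
  shows "((\<lambda>t. f (x + t *\<^sub>R axis i 1)) has_vector_derivative partial i f x) (at 0)"
proof -
  have "\<exists>d. ((\<lambda>t. f (x + t *\<^sub>R axis i 1)) has_vector_derivative d) (at 0)"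
    using assms
  proof (induction rule: Ptau_induct)
    case (mulX z f)
    then obtain d where "((\<lambda>t. f (x + t *\<^sub>R axis i 1)) has_vector_derivative d) (at 0)" by blast
    then have "((\<lambda>t. ((x + t *\<^sub>R axis i 1) \<bullet> z) *\<^sub>R f (x + t *\<^sub>R axis i 1)) has_vector_derivative
       (((x + 0 *\<^sub>R axis i 1) \<bullet> z) *\<^sub>R d + (axis i 1 \<bullet> z) *\<^sub>R f (x + 0 *\<^sub>R axis i 1))) (at 0)"
      by (intro has_vector_derivative_scaleR)
        (auto simp: inner_add_left intro!: derivative_eq_intros)
    then show ?case by (auto simp: mulX_def)
  next
    case (add f g)
    then show ?case by (auto intro: has_vector_derivative_add)
  qed (auto intro: exI[of _ 0])
  then show ?thesis
    unfolding partial_def by (metis vector_derivative_at)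
qed

lemma partial_eqI:
  "((\<lambda>t. f (x + t *\<^sub>R axis i 1)) has_vector_derivative d) (at 0) \<Longrightarrow> partial i f x = d"
  unfolding partial_def by (rule vector_derivative_at)

lemma partial_const: "partial i (\<lambda>x. u) = (\<lambda>x. 0)"
  by (rule ext, rule partial_eqI) simp

lemma partial_add:
  "f \<in> Ptau \<Longrightarrow> g \<in> Ptau \<Longrightarrow> partial i (\<lambda>x. f x + g x) = (\<lambda>x. partial i f x + partial i g x)"
  by (rule ext, rule partial_eqI) (intro has_vector_derivative_add Ptau_has_partial)

lemma partial_scaleR:
  "f \<in> Ptau \<Longrightarrow> partial i (\<lambda>x. a *\<^sub>R f x) = (\<lambda>x. a *\<^sub>R partial i f x)"
  by (rule ext, rule partial_eqI)
    (intro bounded_linear.has_vector_derivative[OF bounded_linear_scaleR_right] Ptau_has_partial)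

lemma partial_mulX:
  assumes "f \<in> Ptau"
  shows "partial i (mulX z f) = (\<lambda>x. mulX z (partial i f) x + z$i *\<^sub>R f x)"
proof (rule ext, rule partial_eqI)
  fix x
  have "((\<lambda>t. ((x + t *\<^sub>R axis i 1) \<bullet> z) *\<^sub>R f (x + t *\<^sub>R axis i 1)) has_vector_derivative
       (((x + 0 *\<^sub>R axis i 1) \<bullet> z) *\<^sub>R partial i f x + (axis i 1 \<bullet> z) *\<^sub>R f (x + 0 *\<^sub>R axis i 1))) (at 0)"
    using Ptau_has_partial[OF assms]
    by (intro has_vector_derivative_scaleR)
      (auto simp: inner_add_left intro!: derivative_eq_intros)
  then show "((\<lambda>t. mulX z f (x + t *\<^sub>R axis i 1)) has_vector_derivative
      mulX z (partial i f) x + z $ i *\<^sub>R f x) (at 0)"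
    by (simp add: mulX_def inner_axis')
qed

text \<open>The degree \<open>n - 1\<close> is truncated at \<open>n = 0\<close>. There the
  derivative has to be known to vanish, since otherwise \<open>mulX z (partial i f)\<close> would
  have degree \<open>1\<close> instead of \<open>0\<close> in the induction step.\<close>

lemma partial_Phom:
  assumes "f \<in> Phom n"
  shows "partial i f \<in> Phom (n - 1) \<and> (n = 0 \<longrightarrow> partial i f = (\<lambda>x. 0))"
  using assms
proof (induction rule: Phom_induct)
  case (mulX n z f)
  have "mulX z (partial i f) \<in> Phom n"
  proof (cases n)
    case 0
    then show ?thesis using mulX.IH by (simp add: mulX_def Phom_zero)
  next
    case (Suc m)
    then show ?thesis using mulX.IH Phom_mulX by force
  qed
  then show ?case
    using mulX.hyps by (simp add: partial_mulX Phom_Ptau Phom_add Phom_scaleR)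
qed (auto simp: partial_const partial_add Phom_zero Phom_add Phom_Ptau)

lemma partial_Ptau: "f \<in> Ptau \<Longrightarrow> partial i f \<in> Ptau"
  by (induction rule: Ptau_induct) (auto simp: partial_const partial_add partial_mulX)

section \<open>Reflections and divided differences\<close>

definition rfl :: "real^'n::finite \<Rightarrow> real^'n \<Rightarrow> real^'n" where
  "rfl v x = x - (2 * (x \<bullet> v) / (v \<bullet> v)) *\<^sub>R v"

lemma refl_mat_sym: "transpose (refl_mat v) = refl_mat v"
  by (simp add: refl_mat_def transpose_def mat_def vec_eq_iff mult_ac)

lemma vector_refl_mat: "x v* refl_mat v = rfl v x"
proof -
  have "x v* (\<chi> i j. v$i * v$j) = (x \<bullet> v) *\<^sub>R v"
    by (simp add: vec_eq_iff vector_matrix_mult_def inner_vec_def sum_distrib_left mult_ac)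
  then show ?thesis
    by (simp add: refl_mat_def rfl_def vector_matrix_mult_diff_rdistrib vector_scaleR_matrix_ac)
qed

lemma refl_mat_vector: "refl_mat v *v x = rfl v x"
  by (metis refl_mat_sym transpose_matrix_vector vector_refl_mat)

lemma rfl_rfl [simp]: "v \<noteq> 0 \<Longrightarrow> rfl v (rfl v x) = x"
  by (simp add: rfl_def inner_diff_left algebra_simps)

lemma rfl_inner: "v \<noteq> 0 \<Longrightarrow> rfl v x \<bullet> rfl v y = x \<bullet> y"
  by (simp add: rfl_def inner_diff_left inner_diff_right inner_commute field_simps)

lemma rfl_inner_swap: "v \<noteq> 0 \<Longrightarrow> rfl v x \<bullet> y = x \<bullet> rfl v y"
  by (simp add: rfl_def inner_diff_left inner_diff_right inner_commute field_simps)

lemma rfl_self [simp]: "v \<noteq> 0 \<Longrightarrow> rfl v v = - v"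
  by (simp add: rfl_def scaleR_2)

lemma rfl_minus [simp]: "rfl (- v) = rfl v"
  by (simp add: rfl_def fun_eq_iff)

lemma norm_rfl: "v \<noteq> 0 \<Longrightarrow> norm (rfl v x) = norm x"
  by (simp add: norm_eq_sqrt_inner rfl_inner)

lemma linear_rfl: "linear (rfl v)"
  by (rule linearI) (auto simp: rfl_def inner_add_left algebra_simps add_divide_distrib)

text \<open>An isometry conjugates the reflection in a vector into the reflection in the image of
  that vector.\<close>

lemma rfl_conj:
  assumes "r \<noteq> 0"
  shows "rfl v (rfl r x) = rfl r (rfl (rfl r v) x)"
proof -
  have "rfl r (rfl (rfl r v) x) = rfl r (x - (2 * (rfl r x \<bullet> v) / (v \<bullet> v)) *\<^sub>R rfl r v)"
    by (simp add: rfl_def[of "rfl r v"] rfl_inner rfl_inner_swap assms)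
  also have "\<dots> = rfl r x - (2 * (rfl r x \<bullet> v) / (v \<bullet> v)) *\<^sub>R v"
    using assms by (simp add: linear_diff[OF linear_rfl] linear_scale[OF linear_rfl])
  finally show ?thesis by (simp add: rfl_def[of v])
qed

text \<open>Polynomials are continuous and the complement of the hyperplane is dense: a point
  \<open>x\<close> of the hyperplane is approached along \<open>x + t v\<close>. This gives the
  uniqueness in \<open>ddiff\<close> and, later, the injectivity of multiplication by a
  coordinate.\<close>

lemma Ptau_eq_off_hyperplane:
  fixes g h :: "real^'n::finite \<Rightarrow> 'v::real_normed_vector"
  assumes "g \<in> Ptau" "h \<in> Ptau" "v \<noteq> 0" "\<And>x. x \<bullet> v \<noteq> 0 \<Longrightarrow> g x = h x"
  shows "g = h"
proof
  fix x
  show "g x = h x"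
  proof (cases "x \<bullet> v = 0")
    case True
    have cont: "((\<lambda>t. f (x + t *\<^sub>R v)) \<longlongrightarrow> f x) (at 0)" if "f \<in> Ptau" for f :: "real^'n \<Rightarrow> 'v"
    proof -
      have "continuous_on UNIV (\<lambda>t::real. f (x + t *\<^sub>R v))"
        by (rule continuous_on_compose2[OF Ptau_continuous[OF that]]) (auto intro!: continuous_intros)
      then have "isCont (\<lambda>t::real. f (x + t *\<^sub>R v)) 0"
        by (simp add: continuous_on_eq_continuous_at)
      then show ?thesis by (simp add: isCont_def)
    qed
    have "g (x + t *\<^sub>R v) = h (x + t *\<^sub>R v)" if "t \<noteq> 0" for t
      by (rule assms(4)) (use that True \<open>v \<noteq> 0\<close> in \<open>simp add: inner_add_left\<close>)
    then have "((\<lambda>t. g (x + t *\<^sub>R v)) \<longlongrightarrow> h x) (at 0)"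
      using cont[OF assms(2)] by (auto intro: Lim_transform_eventually simp: eventually_at_filter)
    with cont[OF assms(1)] show ?thesis
      by (rule tendsto_unique[rotated]) simp
  qed (rule assms(4))
qed

lemma ddiff_eqI:
  fixes f g :: "real^'n::finite \<Rightarrow> 'v::real_normed_vector"
  assumes "v \<noteq> 0" "g \<in> Ptau" "\<And>x. (x \<bullet> v) *\<^sub>R g x = f x - f (rfl v x)"
  shows "ddiff v f = g"
  unfolding ddiff_def vector_refl_mat
proof (rule the_equality)
  have 1: "g x = (1 / (x \<bullet> v)) *\<^sub>R (f x - f (rfl v x))" if "x \<bullet> v \<noteq> 0" for x
    using that by (simp flip: assms(3))
  with assms(2) show "g \<in> Ptau \<and> (\<forall>x. x \<bullet> v \<noteq> 0 \<longrightarrow> g x = (1 / (x \<bullet> v)) *\<^sub>R (f x - f (rfl v x)))"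
    by blast
  fix h assume "h \<in> Ptau \<and> (\<forall>x. x \<bullet> v \<noteq> 0 \<longrightarrow> h x = (1 / (x \<bullet> v)) *\<^sub>R (f x - f (rfl v x)))"
  then show "h = g" by (intro Ptau_eq_off_hyperplane[OF _ assms(2,1)]) (auto simp: 1)
qed

text \<open>A twisted Leibniz rule. Replacing \<open>x\<close> by its mirror image first in
  \<open>f\<close> and then in the linear form leaves the error
  \<open>x \<bullet> z - rfl v x \<bullet> z\<close>, which is a multiple of
  \<open>x \<bullet> v\<close>.\<close>

lemma mulX_divided_difference:
  assumes "(x \<bullet> v) *\<^sub>R g x = f x - f (rfl v x)"
  shows "(x \<bullet> v) *\<^sub>R (mulX z g x + (2 * (z \<bullet> v) / (v \<bullet> v)) *\<^sub>R f (rfl v x))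
    = mulX z f x - mulX z f (rfl v x)"
proof -
  have 1: "(x \<bullet> v) *\<^sub>R mulX z g x = (x \<bullet> z) *\<^sub>R (f x - f (rfl v x))"
    by (simp add: mulX_def mult.commute flip: assms)
  have 2: "(x \<bullet> v) * (2 * (z \<bullet> v) / (v \<bullet> v)) = x \<bullet> z - rfl v x \<bullet> z"
    by (simp add: rfl_def inner_diff_left) (simp add: inner_commute)
  show ?thesis
    unfolding scaleR_add_right scaleR_scaleR 1 2 by (simp add: mulX_def algebra_simps)
qed

text \<open>The twisted Leibniz rule builds up the quotient by \<open>x \<bullet> v\<close> along
  the induction. The clause for \<open>n = 0\<close> makes up for the truncated subtraction in
  \<open>n - 1\<close>.\<close>

lemma ddiff_exists:
  fixes f :: "real^'n::finite \<Rightarrow> 'v::real_normed_vector"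
  assumes "f \<in> Phom n" "v \<noteq> 0"
  shows "\<exists>g\<in>Phom (n - 1). (n = 0 \<longrightarrow> g = (\<lambda>x. 0)) \<and> (\<forall>x. (x \<bullet> v) *\<^sub>R g x = f x - f (rfl v x))"
  using assms(1)
proof (induction rule: Phom_induct)
  case (const u)
  then show ?case by (auto intro!: bexI[of _ "\<lambda>x. 0"] Phom_zero)
next
  case (add n f g)
  then obtain f' g' where *: "f' \<in> Phom (n - 1)" "n = 0 \<longrightarrow> f' = (\<lambda>x. 0)"
    "\<And>x. (x \<bullet> v) *\<^sub>R f' x = f x - f (rfl v x)"
    "g' \<in> Phom (n - 1)" "n = 0 \<longrightarrow> g' = (\<lambda>x. 0)"
    "\<And>x. (x \<bullet> v) *\<^sub>R g' x = g x - g (rfl v x)" by metis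
  show ?case
    by (rule bexI[of _ "\<lambda>x. f' x + g' x"]) (use * in \<open>auto simp: scaleR_add_right Phom_add\<close>)
next
  case (mulX n z f)
  then obtain f' where *: "f' \<in> Phom (n - 1)" "n = 0 \<longrightarrow> f' = (\<lambda>x. 0)"
    "\<And>x. (x \<bullet> v) *\<^sub>R f' x = f x - f (rfl v x)" by blast
  have "mulX z f' \<in> Phom n"
  proof (cases n)
    case 0
    then show ?thesis using * by (simp add: mulX_def Phom_zero)
  next
    case (Suc m)
    then show ?thesis using * Phom_mulX by force
  qed
  moreover have "(\<lambda>x. f (rfl v x)) \<in> Phom n"
    using Phom_compose[OF mulX.hyps, of "refl_mat v"] by (simp add: vector_refl_mat)
  ultimately show ?case
    by (intro bexI[of _ "\<lambda>x. mulX z f' x + (2 * (z \<bullet> v) / (v \<bullet> v)) *\<^sub>R f (rfl v x)"] conjI allI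
        mulX_divided_difference *) (auto intro: Phom_add Phom_scaleR)
qed

lemma ddiff_Phom:
  fixes f :: "real^'n::finite \<Rightarrow> 'v::real_normed_vector"
  assumes "f \<in> Phom n" "v \<noteq> 0"
  shows "ddiff v f \<in> Phom (n - 1)" "n = 0 \<Longrightarrow> ddiff v f = (\<lambda>x. 0)"
  using ddiff_exists[OF assms] ddiff_eqI[OF assms(2)] Phom_Ptau by metis+

lemma ddiff_Ptau:
  fixes f :: "real^'n::finite \<Rightarrow> 'v::real_normed_vector"
  assumes "f \<in> Ptau" "v \<noteq> 0"
  shows "ddiff v f \<in> Ptau" "(x \<bullet> v) *\<^sub>R ddiff v f x = f x - f (rfl v x)"
proof -
  obtain d h where h: "\<And>n. h n \<in> Phom n" and f: "f = (\<lambda>x. \<Sum>n<d. h n x)"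
    using assms(1) by (rule Ptau_sum_Phom) blast
  obtain g where g: "\<And>n. g n \<in> Phom (n - 1)" "\<And>n x. (x \<bullet> v) *\<^sub>R g n x = h n x - h n (rfl v x)"
    using ddiff_exists[OF h assms(2)] by metis
  define k where "k x = (\<Sum>n<d. g n x)" for x
  have k: "k \<in> Ptau" unfolding k_def using g(1) Phom_Ptau by (intro Ptau_sum) blast
  have k2: "(x \<bullet> v) *\<^sub>R k x = f x - f (rfl v x)" for x
    by (simp add: k_def f scaleR_sum_right g(2) sum_subtractf)
  have "ddiff v f = k" by (rule ddiff_eqI[OF assms(2) k k2])
  with k k2 show "ddiff v f \<in> Ptau" "(x \<bullet> v) *\<^sub>R ddiff v f x = f x - f (rfl v x)" by auto
qed

lemma ddiff_const: "v \<noteq> 0 \<Longrightarrow> ddiff v (\<lambda>x. u :: 'v::real_normed_vector) = (\<lambda>x. 0)"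
  by (rule ddiff_eqI) auto

lemma ddiff_add:
  fixes f g :: "real^'n::finite \<Rightarrow> 'v::real_normed_vector"
  assumes "f \<in> Ptau" "g \<in> Ptau" "v \<noteq> 0"
  shows "ddiff v (\<lambda>x. f x + g x) = (\<lambda>x. ddiff v f x + ddiff v g x)"
  by (rule ddiff_eqI) (use assms in \<open>auto simp: ddiff_Ptau scaleR_add_right\<close>)

lemma ddiff_scaleR:
  fixes f :: "real^'n::finite \<Rightarrow> 'v::real_normed_vector"
  assumes "f \<in> Ptau" "v \<noteq> 0"
  shows "ddiff v (\<lambda>x. a *\<^sub>R f x) = (\<lambda>x. a *\<^sub>R ddiff v f x)"
proof (rule ddiff_eqI[OF assms(2)])
  show "(x \<bullet> v) *\<^sub>R a *\<^sub>R ddiff v f x = a *\<^sub>R f x - a *\<^sub>R f (rfl v x)" for x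
    using ddiff_Ptau(2)[OF assms, of x] by (metis scaleR_left_commute scaleR_right_diff_distrib)
qed (use assms in \<open>auto simp: ddiff_Ptau\<close>)

lemma ddiff_mulX:
  fixes f :: "real^'n::finite \<Rightarrow> 'v::real_normed_vector"
  assumes "f \<in> Ptau" "v \<noteq> 0"
  shows "ddiff v (mulX z f) = (\<lambda>x. mulX z (ddiff v f) x + (2 * (z \<bullet> v) / (v \<bullet> v)) *\<^sub>R f (rfl v x))"
proof (rule ddiff_eqI[OF assms(2)])
  show "(\<lambda>x. mulX z (ddiff v f) x + (2 * (z \<bullet> v) / (v \<bullet> v)) *\<^sub>R f (rfl v x)) \<in> Ptau"
    using Ptau_compose[OF assms(1), of "refl_mat v"]
    by (intro Ptau_add Ptau_scaleR Ptau_mulX ddiff_Ptau assms) (simp add: vector_refl_mat)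
qed (intro mulX_divided_difference ddiff_Ptau assms)

section \<open>Dunkl operators\<close>

lemma refl_mat_minus [simp]: "refl_mat (- v) = refl_mat v"
  by (simp add: refl_mat_def)

lemma refl_mat_square: "v \<noteq> 0 \<Longrightarrow> refl_mat v ** refl_mat v = mat 1"
  by (simp add: matrix_eq refl_mat_vector flip: matrix_vector_mul_assoc)

lemma refl_mat_conj: "r \<noteq> 0 \<Longrightarrow> refl_mat r ** refl_mat v = refl_mat (rfl r v) ** refl_mat r"
  using rfl_conj[of r v] by (simp add: matrix_eq refl_mat_vector flip: matrix_vector_mul_assoc) (metis rfl_rfl)

lemma partial_euler:
  assumes "f \<in> Phom n"
  shows "(\<Sum>i\<in>UNIV. x$i *\<^sub>R partial i f x) = real n *\<^sub>R f x"
  using assms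
proof (induction rule: Phom_induct)
  case (mulX n z f)
  have "(\<Sum>i\<in>UNIV. x$i *\<^sub>R partial i (mulX z f) x)
      = (\<Sum>i\<in>UNIV. (x \<bullet> z) *\<^sub>R (x$i *\<^sub>R partial i f x) + (x$i * z$i) *\<^sub>R f x)"
    by (intro sum.cong) (simp_all add: partial_mulX[OF Phom_Ptau[OF mulX.hyps]] mulX_apply algebra_simps)
  also have "\<dots> = (x \<bullet> z) *\<^sub>R (real n *\<^sub>R f x) + (x \<bullet> z) *\<^sub>R f x"
    unfolding sum.distrib mulX.IH[symmetric] scaleR_sum_right[symmetric] scaleR_sum_left[symmetric]
    by (simp add: inner_vec_def)
  finally show ?case by (simp add: mulX_apply[of z f x] algebra_simps)
qed (auto simp: partial_const partial_add Phom_Ptau sum.distrib algebra_simps)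

lemma sum_components: "(\<Sum>i\<in>UNIV. y$i * v$i) = y \<bullet> (v :: real^'n::finite)"
  by (simp add: inner_vec_def)

section \<open>Roots and the action of the reflection group\<close>

locale dunkl =
  fixes R Rp :: "(real^'n::finite) set"
    and \<tau> :: "real^'n^'n \<Rightarrow> 'v::euclidean_space \<Rightarrow> 'v"
  assumes root_system: "reduced_root_system R"
    and pos_roots: "positive_roots R Rp"
    and irrep: "orth_irrep R \<tau>"
begin

lemma root_nonzero: "v \<in> R \<Longrightarrow> v \<noteq> 0"
  using root_system by (auto simp: reduced_root_system_def)

lemma rfl_root: "r \<in> R \<Longrightarrow> v \<in> R \<Longrightarrow> rfl r v \<in> R"
  using root_system unfolding reduced_root_system_def vector_refl_mat by blast

lemma minus_root: "v \<in> R \<Longrightarrow> - v \<in> R"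
  using rfl_root[of v v] root_nonzero[of v] by simp

lemma Rp_subset: "Rp \<subseteq> R"
  using pos_roots by (auto simp: positive_roots_def)

lemma finite_roots: "finite R" "finite Rp"
  using root_system Rp_subset finite_subset by (auto simp: reduced_root_system_def)

lemma Rp_root: "v \<in> Rp \<Longrightarrow> v \<in> R" and Rp_nonzero: "v \<in> Rp \<Longrightarrow> v \<noteq> 0"
  using Rp_subset root_nonzero by auto

text \<open>\<open>R\<close> is the disjoint union of \<open>Rp\<close> and its negative, because no
  root is orthogonal to the vector \<open>b\<close> that selects the positive ones.\<close>

lemma sum_roots_even:
  fixes G :: "real^'n \<Rightarrow> 'b::real_vector"
  assumes "\<And>v. G (- v) = G v"
  shows "(\<Sum>v\<in>R. G v) = 2 *\<^sub>R (\<Sum>v\<in>Rp. G v)"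
proof -
  obtain b where b: "\<And>v. v \<in> R \<Longrightarrow> v \<bullet> b \<noteq> 0" "Rp = {v\<in>R. v \<bullet> b > 0}"
    using pos_roots by (auto simp: positive_roots_def)
  have R: "R = Rp \<union> uminus ` Rp"
  proof
    show "R \<subseteq> Rp \<union> uminus ` Rp"
    proof
      fix v assume v: "v \<in> R"
      consider "v \<bullet> b > 0" | "v \<bullet> b < 0" using b(1)[OF v] by linarith
      then show "v \<in> Rp \<union> uminus ` Rp"
      proof cases
        case 2
        then have "- v \<in> Rp" using v minus_root by (simp add: b(2))
        then show ?thesis by (metis UnI2 image_eqI minus_minus)
      qed (use v in \<open>simp add: b(2)\<close>)
    qed
  qed (use Rp_subset minus_root in auto)
  have "Rp \<inter> uminus ` Rp = {}" by (auto simp: b(2))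
  then have "(\<Sum>v\<in>R. G v) = (\<Sum>v\<in>Rp. G v) + (\<Sum>v\<in>uminus ` Rp. G v)"
    by (subst R, intro sum.union_disjoint) (auto simp: finite_roots)
  also have "(\<Sum>v\<in>uminus ` Rp. G v) = (\<Sum>v\<in>Rp. G v)"
    by (subst sum.reindex) (auto simp: assms)
  finally show ?thesis by (simp add: scaleR_2)
qed

text \<open>A reflection permutes \<open>R\<close> but not \<open>Rp\<close>, so the sum is
  reindexed over all of \<open>R\<close>; evenness of \<open>G\<close> allows the passage there and
  back.\<close>

lemma sum_pos_roots_rfl:
  fixes G :: "real^'n \<Rightarrow> 'b::real_vector"
  assumes "\<And>v. G (- v) = G v" "r \<in> R"
  shows "(\<Sum>v\<in>Rp. G (rfl r v)) = (\<Sum>v\<in>Rp. G v)"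
proof -
  have "2 *\<^sub>R (\<Sum>v\<in>Rp. G (rfl r v)) = (\<Sum>v\<in>R. G (rfl r v))"
    by (rule sum_roots_even[symmetric]) (simp add: assms linear_neg[OF linear_rfl])
  also have "\<dots> = (\<Sum>v\<in>R. G v)"
    by (rule sum.reindex_bij_witness[of _ "rfl r" "rfl r"])
      (use assms(2) root_nonzero rfl_root in auto)
  also have "\<dots> = 2 *\<^sub>R (\<Sum>v\<in>Rp. G v)" by (rule sum_roots_even) (rule assms)
  finally show ?thesis by simp
qed

lemma refl_mat_reflgroup: "v \<in> R \<Longrightarrow> refl_mat v \<in> reflgroup R"
  using reflgroup.step[OF _ reflgroup.one, of v R] by simp

lemma linear_rep: "w \<in> reflgroup R \<Longrightarrow> linear (\<tau> w)"
  and rep_inner: "w \<in> reflgroup R \<Longrightarrow> \<tau> w a \<bullet> \<tau> w b = a \<bullet> b"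
  and rep_mult: "w1 \<in> reflgroup R \<Longrightarrow> w2 \<in> reflgroup R \<Longrightarrow> \<tau> (w1 ** w2) a = \<tau> w1 (\<tau> w2 a)"
  using irrep by (auto simp: orth_irrep_def)

lemma norm_rep: "w \<in> reflgroup R \<Longrightarrow> norm (\<tau> w a) = norm a"
  by (simp add: norm_eq_sqrt_inner rep_inner)

text \<open>\<open>\<tau> (mat 1)\<close> is idempotent by multiplicativity and injective as a
  linear isometry, so it is the identity.\<close>

lemma rep_one: "\<tau> (mat 1) a = a"
proof -
  have "\<tau> (mat 1) (\<tau> (mat 1) a) = \<tau> (mat 1) a"
    using rep_mult[OF reflgroup.one reflgroup.one, of a] by simp
  then have "\<tau> (mat 1) (\<tau> (mat 1) a - a) = 0"
    by (simp add: linear_diff[OF linear_rep[OF reflgroup.one]])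
  then have "norm (\<tau> (mat 1) a - a) = 0"
    by (metis norm_rep[OF reflgroup.one] norm_zero)
  then show ?thesis by simp
qed

abbreviation s :: "real^'n \<Rightarrow> (real^'n \<Rightarrow> 'v) \<Rightarrow> real^'n \<Rightarrow> 'v" where
  "s v \<equiv> Wact \<tau> (refl_mat v)"

lemma s_apply: "s v f x = \<tau> (refl_mat v) (f (rfl v x))"
  by (simp add: Wact_def vector_refl_mat)

lemma Wact_mult:
  "w1 \<in> reflgroup R \<Longrightarrow> w2 \<in> reflgroup R \<Longrightarrow> Wact \<tau> (w1 ** w2) f = Wact \<tau> w1 (Wact \<tau> w2 f)"
  by (simp add: Wact_def rep_mult vector_matrix_mul_assoc)

lemma Wact_one: "Wact \<tau> (mat 1) f = f"
  by (simp add: Wact_def rep_one)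

lemma Wact_Ptau: "w \<in> reflgroup R \<Longrightarrow> f \<in> Ptau \<Longrightarrow> Wact \<tau> w f \<in> Ptau"
  unfolding Wact_def by (intro Ptau_linear[OF Ptau_compose] linear_rep)

lemma s_Ptau: "v \<in> R \<Longrightarrow> f \<in> Ptau \<Longrightarrow> s v f \<in> Ptau"
  by (intro Wact_Ptau refl_mat_reflgroup)

lemma s_const: "s v (\<lambda>x. u) = (\<lambda>x. \<tau> (refl_mat v) u)"
  by (simp add: Wact_def)

lemma s_add: "v \<in> R \<Longrightarrow> s v (\<lambda>x. f x + g x) = (\<lambda>x. s v f x + s v g x)"
  by (simp add: Wact_def linear_add linear_rep refl_mat_reflgroup)

lemma s_scaleR: "v \<in> R \<Longrightarrow> s v (\<lambda>x. a *\<^sub>R f x) = (\<lambda>x. a *\<^sub>R s v f x)"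
  by (simp add: Wact_def linear_scale linear_rep refl_mat_reflgroup)

lemma s_sum: "v \<in> R \<Longrightarrow> s v (\<lambda>x. \<Sum>i\<in>I. f i x) = (\<lambda>x. \<Sum>i\<in>I. s v (f i) x)"
  by (simp add: Wact_def linear_sum linear_rep refl_mat_reflgroup)

lemma s_mulX: "v \<in> R \<Longrightarrow> s v (mulX z f) = mulX (rfl v z) (s v f)"
  by (rule ext) (simp add: s_apply mulX_apply linear_scale linear_rep refl_mat_reflgroup
      rfl_inner_swap root_nonzero)

lemma s_s: "v \<in> R \<Longrightarrow> s v (s v f) = f"
  by (simp add: refl_mat_reflgroup refl_mat_square root_nonzero Wact_one flip: Wact_mult)

lemma s_conj: "r \<in> R \<Longrightarrow> v \<in> R \<Longrightarrow> s r (s v f) = s (rfl r v) (s r f)"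
  by (metis Wact_mult refl_mat_conj refl_mat_reflgroup rfl_root root_nonzero)

section \<open>Dunkl operators in coordinate directions\<close>

abbreviation D :: "real \<Rightarrow> 'n \<Rightarrow> (real^'n \<Rightarrow> 'v) \<Rightarrow> real^'n \<Rightarrow> 'v" where
  "D \<equiv> Dunkl Rp \<tau>"

lemma D_const: "D \<kappa> i (\<lambda>x. u) = (\<lambda>x. 0)"
  by (simp add: Dunkl_def partial_const ddiff_const Rp_nonzero linear_0 linear_rep
      refl_mat_reflgroup Rp_root)

lemma D_add:
  assumes "f \<in> Ptau" "g \<in> Ptau"
  shows "D \<kappa> i (\<lambda>x. f x + g x) = (\<lambda>x. D \<kappa> i f x + D \<kappa> i g x)"
  using assms
  by (simp add: Dunkl_def partial_add ddiff_add Rp_nonzero linear_add linear_rep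
      refl_mat_reflgroup Rp_root sum.distrib algebra_simps)

lemma D_scaleR:
  assumes "f \<in> Ptau"
  shows "D \<kappa> i (\<lambda>x. a *\<^sub>R f x) = (\<lambda>x. a *\<^sub>R D \<kappa> i f x)"
  using assms
  by (simp add: Dunkl_def partial_scaleR ddiff_scaleR Rp_nonzero linear_scale linear_rep
      refl_mat_reflgroup Rp_root scaleR_sum_right scaleR_add_right mult_ac)

lemma D_mulX:
  assumes "f \<in> Ptau"
  shows "D \<kappa> i (mulX z f) x = mulX z (D \<kappa> i f) x + z$i *\<^sub>R f x
    + \<kappa> *\<^sub>R (\<Sum>v\<in>Rp. (v$i * (2 * (z \<bullet> v) / (v \<bullet> v))) *\<^sub>R s v f x)"
proof -
  have "(\<Sum>v\<in>Rp. v$i *\<^sub>R \<tau> (refl_mat v) (ddiff v (mulX z f) x))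
    = (\<Sum>v\<in>Rp. (x \<bullet> z) *\<^sub>R (v$i *\<^sub>R \<tau> (refl_mat v) (ddiff v f x))
        + (v$i * (2 * (z \<bullet> v) / (v \<bullet> v))) *\<^sub>R s v f x)"
  proof (intro sum.cong refl)
    fix v assume v: "v \<in> Rp"
    have lin: "linear (\<tau> (refl_mat v))" using v by (intro linear_rep refl_mat_reflgroup Rp_root)
    have "ddiff v (mulX z f) x = (x \<bullet> z) *\<^sub>R ddiff v f x + (2 * (z \<bullet> v) / (v \<bullet> v)) *\<^sub>R f (rfl v x)"
      unfolding ddiff_mulX[OF assms Rp_nonzero[OF v]] by (simp add: mulX_apply)
    then show "v$i *\<^sub>R \<tau> (refl_mat v) (ddiff v (mulX z f) x)
        = (x \<bullet> z) *\<^sub>R (v$i *\<^sub>R \<tau> (refl_mat v) (ddiff v f x))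
        + (v$i * (2 * (z \<bullet> v) / (v \<bullet> v))) *\<^sub>R s v f x"
      by (simp only: linear_add[OF lin] linear_scale[OF lin] s_apply scaleR_add_right scaleR_scaleR mult.commute)
  qed
  then show ?thesis
    unfolding Dunkl_def
    by (simp add: partial_mulX assms sum.distrib mulX_apply scaleR_add_right scaleR_sum_right mult_ac)
qed

lemma D_Ptau: "f \<in> Ptau \<Longrightarrow> D \<kappa> i f \<in> Ptau"
  unfolding Dunkl_def
  by (intro Ptau_add Ptau_scaleR Ptau_sum partial_Ptau Ptau_linear[OF ddiff_Ptau(1)]
      linear_rep refl_mat_reflgroup Rp_root Rp_nonzero)

lemma D_Phom: "f \<in> Phom n \<Longrightarrow> D \<kappa> i f \<in> Phom (n - 1)"
  unfolding Dunkl_def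
  by (intro Phom_add Phom_scaleR Phom_sum conjunct1[OF partial_Phom] Phom_linear[OF ddiff_Phom(1)]
      linear_rep refl_mat_reflgroup Rp_root Rp_nonzero)

lemma D_0: "D 0 i f = partial i f"
  by (simp add: Dunkl_def)

text \<open>Multiplying by \<open>x$i\<close> and summing over \<open>i\<close> turns the factor
  \<open>v$i\<close> into \<open>x \<bullet> v\<close>, which cancels the denominator of the divided
  difference.\<close>

lemma euler:
  assumes "f \<in> Phom n"
  shows "(\<Sum>i\<in>UNIV. x$i *\<^sub>R D \<kappa> i f x)
    = real n *\<^sub>R f x + \<kappa> *\<^sub>R (\<Sum>v\<in>Rp. \<tau> (refl_mat v) (f x) - s v f x)"
proof -
  have "(\<Sum>i\<in>UNIV. x$i *\<^sub>R (\<Sum>v\<in>Rp. v$i *\<^sub>R \<tau> (refl_mat v) (ddiff v f x)))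
     = (\<Sum>v\<in>Rp. \<tau> (refl_mat v) ((x \<bullet> v) *\<^sub>R ddiff v f x))"
    unfolding scaleR_sum_right
    by (subst sum.swap) (intro sum.cong refl, simp add: linear_scale linear_rep refl_mat_reflgroup
        Rp_root sum_components flip: scaleR_sum_left)
  also have "\<dots> = (\<Sum>v\<in>Rp. \<tau> (refl_mat v) (f x) - s v f x)"
    using assms by (intro sum.cong refl) (simp add: ddiff_Ptau Phom_Ptau Rp_nonzero s_apply
        linear_diff linear_rep refl_mat_reflgroup Rp_root)
  finally have "(\<Sum>i\<in>UNIV. x$i *\<^sub>R (\<Sum>v\<in>Rp. v$i *\<^sub>R \<tau> (refl_mat v) (ddiff v f x)))
      = (\<Sum>v\<in>Rp. \<tau> (refl_mat v) (f x) - s v f x)" .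
  moreover have "(\<Sum>i\<in>UNIV. x$i *\<^sub>R D \<kappa> i f x) = (\<Sum>i\<in>UNIV. x$i *\<^sub>R partial i f x)
     + \<kappa> *\<^sub>R (\<Sum>i\<in>UNIV. x$i *\<^sub>R (\<Sum>v\<in>Rp. v$i *\<^sub>R \<tau> (refl_mat v) (ddiff v f x)))"
    unfolding Dunkl_def scaleR_add_right sum.distrib scaleR_sum_right scaleR_scaleR
    by (simp add: mult_ac)
  ultimately show ?thesis by (simp add: partial_euler[OF assms])
qed

section \<open>Directional Dunkl operators: equivariance and commutativity\<close>

definition DD :: "real \<Rightarrow> real^'n \<Rightarrow> (real^'n \<Rightarrow> 'v) \<Rightarrow> real^'n \<Rightarrow> 'v" where
  "DD \<kappa> y f = (\<lambda>x. \<Sum>i\<in>UNIV. y$i *\<^sub>R D \<kappa> i f x)"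

text \<open>This is the inner product of \<open>y\<close> with \<open>z - rfl v z\<close>. Its
  symmetry in \<open>y\<close> and \<open>z\<close> underlies both the commutativity of the
  operators and the symmetry of the form.\<close>

definition rcoef :: "real^'n \<Rightarrow> real^'n \<Rightarrow> real^'n \<Rightarrow> real" where
  "rcoef v y z = 2 * (y \<bullet> v) * (z \<bullet> v) / (v \<bullet> v)"

lemma rcoef_minus: "rcoef (- v) y z = rcoef v y z"
  by (simp add: rcoef_def)

lemma rcoef_commute: "rcoef v y z = rcoef v z y"
  by (simp add: rcoef_def)

lemma rcoef_rfl: "r \<noteq> 0 \<Longrightarrow> rcoef (rfl r v) (rfl r y) (rfl r z) = rcoef v y z"
  by (simp add: rcoef_def rfl_inner)

lemma DD_axis: "DD \<kappa> (axis i 1) f = D \<kappa> i f"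
  by (simp add: DD_def axis_def if_distrib[of "\<lambda>a. a *\<^sub>R _"] cong: if_cong)

lemma DD_direction: "DD \<kappa> (y - a *\<^sub>R w) f x = DD \<kappa> y f x - a *\<^sub>R DD \<kappa> w f x"
  by (simp add: DD_def scaleR_diff_left sum_subtractf scaleR_sum_right)

lemma DD_const: "DD \<kappa> y (\<lambda>x. u) = (\<lambda>x. 0)"
  by (simp add: DD_def D_const)

lemma DD_add: "f \<in> Ptau \<Longrightarrow> g \<in> Ptau \<Longrightarrow> DD \<kappa> y (\<lambda>x. f x + g x) = (\<lambda>x. DD \<kappa> y f x + DD \<kappa> y g x)"
  by (simp add: DD_def D_add sum.distrib algebra_simps)

lemma DD_scaleR: "f \<in> Ptau \<Longrightarrow> DD \<kappa> y (\<lambda>x. a *\<^sub>R f x) = (\<lambda>x. a *\<^sub>R DD \<kappa> y f x)"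
  by (simp add: DD_def D_scaleR scaleR_sum_right mult_ac)

lemma DD_sum:
  "(\<And>i. i \<in> I \<Longrightarrow> f i \<in> Ptau) \<Longrightarrow> DD \<kappa> y (\<lambda>x. \<Sum>i\<in>I. f i x) = (\<lambda>x. \<Sum>i\<in>I. DD \<kappa> y (f i) x)"
  by (induction I rule: infinite_finite_induct) (auto simp: DD_const DD_add Ptau_sum)

lemma DD_Ptau: "f \<in> Ptau \<Longrightarrow> DD \<kappa> y f \<in> Ptau"
  unfolding DD_def by (intro Ptau_sum Ptau_scaleR D_Ptau)

lemma DD_mulX:
  assumes "f \<in> Ptau"
  shows "DD \<kappa> y (mulX z f)
    = (\<lambda>x. mulX z (DD \<kappa> y f) x + (y \<bullet> z) *\<^sub>R f x + \<kappa> *\<^sub>R (\<Sum>v\<in>Rp. rcoef v y z *\<^sub>R s v f x))"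
proof
  fix x
  have "(\<Sum>i\<in>UNIV. y$i *\<^sub>R (\<Sum>v\<in>Rp. (v$i * (2 * (z \<bullet> v) / (v \<bullet> v))) *\<^sub>R s v f x))
      = (\<Sum>v\<in>Rp. (\<Sum>i\<in>UNIV. y$i * v$i * (2 * (z \<bullet> v) / (v \<bullet> v))) *\<^sub>R s v f x)"
    unfolding scaleR_sum_right scaleR_sum_left
    by (subst sum.swap) (simp add: mult_ac)
  also have "\<dots> = (\<Sum>v\<in>Rp. rcoef v y z *\<^sub>R s v f x)"
    unfolding sum_distrib_right[symmetric] sum_components by (simp add: rcoef_def mult_ac)
  finally have 1: "(\<Sum>i\<in>UNIV. y$i *\<^sub>R (\<Sum>v\<in>Rp. (v$i * (2 * (z \<bullet> v) / (v \<bullet> v))) *\<^sub>R s v f x))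
      = (\<Sum>v\<in>Rp. rcoef v y z *\<^sub>R s v f x)" .
  have 2: "(\<Sum>i\<in>UNIV. y$i *\<^sub>R (z$i *\<^sub>R f x)) = (y \<bullet> z) *\<^sub>R f x"
    by (simp add: inner_vec_def scaleR_sum_left)
  have 3: "(\<Sum>i\<in>UNIV. y$i *\<^sub>R mulX z (D \<kappa> i f) x) = mulX z (DD \<kappa> y f) x"
    by (simp add: mulX_apply DD_def scaleR_sum_right mult_ac)
  have "DD \<kappa> y (mulX z f) x = (\<Sum>i\<in>UNIV. y$i *\<^sub>R mulX z (D \<kappa> i f) x) + (\<Sum>i\<in>UNIV. y$i *\<^sub>R (z$i *\<^sub>R f x))
      + \<kappa> *\<^sub>R (\<Sum>i\<in>UNIV. y$i *\<^sub>R (\<Sum>v\<in>Rp. (v$i * (2 * (z \<bullet> v) / (v \<bullet> v))) *\<^sub>R s v f x))"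
    unfolding DD_def[of \<kappa> y "mulX z f"] D_mulX[OF assms] scaleR_add_right sum.distrib
    by (simp add: scaleR_sum_right mult_ac)
  then show "DD \<kappa> y (mulX z f) x
      = mulX z (DD \<kappa> y f) x + (y \<bullet> z) *\<^sub>R f x + \<kappa> *\<^sub>R (\<Sum>v\<in>Rp. rcoef v y z *\<^sub>R s v f x)"
    unfolding 1 2 3 .
qed

text \<open>Both sides kill constants, and they obey the same rule for \<open>mulX\<close> once the
  sum over the positive roots is reindexed by \<open>rfl r\<close>.\<close>

lemma DD_equivariant:
  assumes "f \<in> Ptau" "r \<in> R"
  shows "s r (DD \<kappa> y f) = DD \<kappa> (rfl r y) (s r f)"
  using assms(1)
proof (induction rule: Ptau_induct)
  case (const u)
  then show ?case using assms(2) by (simp add: DD_const s_const linear_0 linear_rep refl_mat_reflgroup)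
next
  case (add f g)
  then show ?case using assms(2) by (simp add: DD_add s_add s_Ptau)
next
  case (mulX z f)
  have r: "r \<noteq> 0" using assms(2) by (rule root_nonzero)
  \<comment> \<open>The summand belonging to the transformed data; it is even in the root
    \<open>v\<close>, as the reindexing requires.\<close>
  define G where "G x v = rcoef v (rfl r y) (rfl r z) *\<^sub>R s v (s r f) x" for x v
  have G: "(\<Sum>v\<in>Rp. rcoef v y z *\<^sub>R s r (s v f) x) = (\<Sum>v\<in>Rp. G x v)" for x
  proof -
    have "(\<Sum>v\<in>Rp. rcoef v y z *\<^sub>R s r (s v f) x) = (\<Sum>v\<in>Rp. G x (rfl r v))"
      by (intro sum.cong refl) (simp add: G_def rcoef_rfl r s_conj assms(2) Rp_root)
    also have "\<dots> = (\<Sum>v\<in>Rp. G x v)"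
      by (intro sum_pos_roots_rfl assms(2)) (simp add: G_def rcoef_minus)
    finally show ?thesis .
  qed
  have "s r (DD \<kappa> y (mulX z f)) = (\<lambda>x. mulX (rfl r z) (s r (DD \<kappa> y f)) x + (y \<bullet> z) *\<^sub>R s r f x
      + \<kappa> *\<^sub>R (\<Sum>v\<in>Rp. rcoef v y z *\<^sub>R s r (s v f) x))"
    using assms(2) by (simp add: DD_mulX mulX.hyps s_add s_mulX s_scaleR s_sum)
  also have "\<dots> = DD \<kappa> (rfl r y) (mulX (rfl r z) (s r f))"
    using mulX assms(2) by (simp add: DD_mulX s_Ptau G rfl_inner r) (simp add: G_def)
  also have "\<dots> = DD \<kappa> (rfl r y) (s r (mulX z f))"
    by (simp add: s_mulX assms(2))
  finally show ?case .
qed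

text \<open>The commutator of two Dunkl operators kills constants and commutes with every
  multiplication operator: in the expansion below only the terms symmetric in
  the two directions survive.\<close>

lemma DD_commute:
  assumes "f \<in> Ptau"
  shows "DD \<kappa> y (DD \<kappa> z f) = DD \<kappa> z (DD \<kappa> y f)"
  using assms
proof (induction arbitrary: y z rule: Ptau_induct)
  case (mulX u f)
  \<comment> \<open>Equivariance, with \<open>rfl v y\<close> written as \<open>y\<close> minus a
    multiple of \<open>v\<close>.\<close>
  have s_DD: "s v (DD \<kappa> y f) x = DD \<kappa> y (s v f) x - (2 * (y \<bullet> v) / (v \<bullet> v)) *\<^sub>R DD \<kappa> v (s v f) x"
    if "v \<in> Rp" for v y x
    using DD_equivariant[OF mulX.hyps Rp_root[OF that]] by (simp add: rfl_def DD_direction)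
  have expand: "DD \<kappa> y (DD \<kappa> z (mulX u f)) x
    = mulX u (DD \<kappa> y (DD \<kappa> z f)) x + ((y \<bullet> u) *\<^sub>R DD \<kappa> z f x + (z \<bullet> u) *\<^sub>R DD \<kappa> y f x)
      + \<kappa> *\<^sub>R ((\<Sum>v\<in>Rp. rcoef v y u *\<^sub>R DD \<kappa> z (s v f) x) + (\<Sum>v\<in>Rp. rcoef v z u *\<^sub>R DD \<kappa> y (s v f) x)
        - (\<Sum>v\<in>Rp. (4 * (y \<bullet> v) * (z \<bullet> v) * (u \<bullet> v) / (v \<bullet> v)\<^sup>2) *\<^sub>R DD \<kappa> v (s v f) x))"
    for y z x
  proof -
    have sP: "s v f \<in> Ptau" if "v \<in> Rp" for v
      using that mulX.hyps by (intro s_Ptau Rp_root)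
    have "(\<Sum>v\<in>Rp. rcoef v y u *\<^sub>R s v (DD \<kappa> z f) x)
      = (\<Sum>v\<in>Rp. rcoef v y u *\<^sub>R DD \<kappa> z (s v f) x
        - (4 * (y \<bullet> v) * (z \<bullet> v) * (u \<bullet> v) / (v \<bullet> v)\<^sup>2) *\<^sub>R DD \<kappa> v (s v f) x)"
      by (intro sum.cong refl)
        (simp add: s_DD rcoef_def scaleR_diff_right power2_eq_square mult_ac)
    then have 1: "(\<Sum>v\<in>Rp. rcoef v y u *\<^sub>R s v (DD \<kappa> z f) x)
      = (\<Sum>v\<in>Rp. rcoef v y u *\<^sub>R DD \<kappa> z (s v f) x)
        - (\<Sum>v\<in>Rp. (4 * (y \<bullet> v) * (z \<bullet> v) * (u \<bullet> v) / (v \<bullet> v)\<^sup>2) *\<^sub>R DD \<kappa> v (s v f) x)"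
      by (simp add: sum_subtractf)
    have "DD \<kappa> y (DD \<kappa> z (mulX u f)) x
      = DD \<kappa> y (mulX u (DD \<kappa> z f)) x + (z \<bullet> u) *\<^sub>R DD \<kappa> y f x
        + \<kappa> *\<^sub>R (\<Sum>v\<in>Rp. rcoef v z u *\<^sub>R DD \<kappa> y (s v f) x)"
      unfolding DD_mulX[OF mulX.hyps]
      by (simp add: DD_add DD_scaleR DD_sum mulX.hyps sP Ptau_add Ptau_scaleR Ptau_sum Ptau_mulX DD_Ptau)
    also have "DD \<kappa> y (mulX u (DD \<kappa> z f)) x = mulX u (DD \<kappa> y (DD \<kappa> z f)) x + (y \<bullet> u) *\<^sub>R DD \<kappa> z f x
        + \<kappa> *\<^sub>R (\<Sum>v\<in>Rp. rcoef v y u *\<^sub>R s v (DD \<kappa> z f) x)"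
      by (simp add: DD_mulX DD_Ptau mulX.hyps)
    finally show ?thesis unfolding 1 by (simp add: algebra_simps)
  qed
  show ?case
    by (rule ext, unfold expand) (simp add: mulX.IH[of y z] mult_ac add_ac)
qed (auto simp: DD_const DD_add DD_Ptau)

lemma D_commute: "f \<in> Ptau \<Longrightarrow> D \<kappa> i (D \<kappa> j f) = D \<kappa> j (D \<kappa> i f)"
  using DD_commute[of f \<kappa> "axis i 1" "axis j 1"] by (simp add: DD_axis)

end

section \<open>The contravariant form\<close>

lemma multi_index_induct [case_names zero Suc]:
  fixes \<alpha> :: "'n::finite \<Rightarrow> nat"
  assumes "P (\<lambda>_. 0)" "\<And>\<alpha> i. P \<alpha> \<Longrightarrow> P (\<alpha>(i := Suc (\<alpha> i)))"
  shows "P \<alpha>"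
proof (induction "mdeg \<alpha>" arbitrary: \<alpha>)
  case 0
  then have "\<alpha> = (\<lambda>_. 0)" using mdeg_0_iff[of \<alpha>] by auto
  then show ?case using assms(1) by simp
next
  case (Suc n)
  from Suc(2)[symmetric] obtain i \<beta> where b: "\<alpha> = \<beta>(i := Suc (\<beta> i))" "mdeg \<beta> = n" by (rule mdeg_SucE)
  show ?case unfolding b(1) by (rule assms(2)[OF Suc(1)[OF b(2)[symmetric]]])
qed

lemma mono_Ptau: "mono p \<in> Ptau"
  using mono_Phom[of "fst p" "snd p"] Phom_Ptau by auto

lemma mono_at_0:
  fixes \<alpha> :: "'n::finite \<Rightarrow> nat" and u :: "'v::real_vector"
  shows "mono (\<alpha>, u) 0 = (if \<alpha> = (\<lambda>_. 0) then u else 0)"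
proof (cases "\<alpha> = (\<lambda>_. 0)")
  case False
  then obtain i where "\<alpha> i \<noteq> 0" by auto
  then have "monomial \<alpha> (0 :: real^'n) = 0"
    unfolding monomial_def by (intro prod_zero) auto
  then show ?thesis using False by (simp add: mono_def)
qed (simp add: mono_def monomial_def)

text \<open>When \<open>\<alpha> i = 0\<close> the exponent \<open>\<alpha> i - 1\<close> is
  truncated to \<open>0\<close>, but then the factor in front vanishes.\<close>

lemma partial_mono:
  "partial i (mono (\<alpha>, u)) = (\<lambda>x. real (\<alpha> i) *\<^sub>R mono (\<alpha>(i := \<alpha> i - 1), u) x)"
proof (induction \<alpha> rule: multi_index_induct)
  case zero
  show ?case by (simp add: mono_0 partial_const)
next
  case (Suc \<alpha> j)
  have eq: "partial i (mono (\<alpha>(j := Suc (\<alpha> j)), u)) = (\<lambda>x. x$j *\<^sub>R (real (\<alpha> i) *\<^sub>R mono (\<alpha>(i := \<alpha> i - 1), u) x)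
      + (if i = j then 1 else 0) *\<^sub>R mono (\<alpha>, u) x)"
    unfolding mono_Suc partial_mulX[OF mono_Ptau] Suc unfolding mulX_axis by (simp add: axis_def)
  show ?case
  proof (cases "i = j")
    case True
    have "x$j *\<^sub>R (real (\<alpha> j) *\<^sub>R mono (\<alpha>(j := \<alpha> j - 1), u) x) = real (\<alpha> j) *\<^sub>R mono (\<alpha>, u) x" for x
    proof (cases "\<alpha> j = 0")
      case False
      then have "\<alpha> = (\<alpha>(j := \<alpha> j - 1))(j := Suc ((\<alpha>(j := \<alpha> j - 1)) j))" by auto
      then have "mono (\<alpha>, u) x = x$j *\<^sub>R mono (\<alpha>(j := \<alpha> j - 1), u) x"
        by (metis mono_Suc mulX_axis)
      then show ?thesis by simp
    qed simp
    moreover have "(\<alpha>(j := Suc (\<alpha> j)))(i := (\<alpha>(j := Suc (\<alpha> j))) i - 1) = \<alpha>" using True by auto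
    ultimately show ?thesis
      unfolding eq using True by (simp only: scaleR_left_distrib) (simp add: scaleR_left_distrib add.commute)
  next
    case False
    then have "(\<alpha>(j := Suc (\<alpha> j)))(i := \<alpha> i - 1) = (\<alpha>(i := \<alpha> i - 1))(j := Suc ((\<alpha>(i := \<alpha> i - 1)) j))"
      by auto
    then have *: "mono ((\<alpha>(j := Suc (\<alpha> j)))(i := \<alpha> i - 1), u) = (\<lambda>x. x$j *\<^sub>R mono (\<alpha>(i := \<alpha> i - 1), u) x)"
      by (simp only: mono_Suc mulX_axis)
    have "(\<alpha>(j := Suc (\<alpha> j))) i = \<alpha> i" using False by simp
    then show ?thesis unfolding eq by (simp only: *) (simp add: False mult.commute)
  qed
qed

definition ifact :: "('n::finite \<Rightarrow> nat) \<Rightarrow> real" where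
  "ifact \<alpha> = (\<Prod>i\<in>UNIV. fact (\<alpha> i))"

lemma ifact_Suc: "ifact (\<alpha>(i := Suc (\<alpha> i))) = real (Suc (\<alpha> i)) * ifact \<alpha>"
proof -
  have "ifact (\<alpha>(i := Suc (\<alpha> i))) = (\<Prod>j\<in>UNIV. (if j = i then real (Suc (\<alpha> i)) else 1) * fact (\<alpha> j))"
    unfolding ifact_def by (intro prod.cong) auto
  then show ?thesis by (simp add: prod.distrib ifact_def)
qed

lemma ifact_nonzero: "ifact \<alpha> \<noteq> 0"
  by (simp add: ifact_def)

lemma Phom_0_const: "f \<in> Phom 0 \<Longrightarrow> \<exists>u. f = (\<lambda>x. u)"
proof -
  assume "f \<in> Phom 0"
  then obtain A c where A: "\<And>\<alpha>. \<alpha> \<in> A \<Longrightarrow> mdeg \<alpha> = 0" "f = (\<lambda>x. \<Sum>\<alpha>\<in>A. mono (\<alpha>, c \<alpha>) x)"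
    by (rule PhomE) blast
  have "f = (\<lambda>x. \<Sum>\<alpha>\<in>A. c \<alpha>)"
    unfolding A(2)
  proof (intro ext sum.cong refl)
    fix x \<alpha> assume "\<alpha> \<in> A"
    then have "\<alpha> = (\<lambda>_. 0)" using A(1) mdeg_0_iff by blast
    then show "mono (\<alpha>, c \<alpha>) x = c \<alpha>" by (simp add: mono_0)
  qed
  then show ?thesis by blast
qed

lemma Phom_at_0:
  assumes "f \<in> Phom n" "n \<noteq> 0"
  shows "f 0 = 0"
proof -
  obtain A c where A: "\<And>\<alpha>. \<alpha> \<in> A \<Longrightarrow> mdeg \<alpha> = n" "f = (\<lambda>x. \<Sum>\<alpha>\<in>A. mono (\<alpha>, c \<alpha>) x)"
    using assms(1) by (rule PhomE) blast
  have "(\<lambda>_. 0) \<notin> A" using A(1)[of "\<lambda>_. 0"] assms(2) by (auto simp: mdeg_def)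
  then show ?thesis unfolding A(2) by (intro sum.neutral) (auto simp: mono_at_0)
qed

section \<open>Iterated Dunkl operators and the definition of the form\<close>

context dunkl
begin

text \<open>The degree serves as a counter because multi-indices have no structural recursion. If it
  starts as \<open>mdeg \<alpha>\<close>, every choice by \<open>SOME\<close> meets a nonzero
  exponent.\<close>

primrec Dpow_aux :: "nat \<Rightarrow> real \<Rightarrow> ('n \<Rightarrow> nat) \<Rightarrow> (real^'n \<Rightarrow> 'v) \<Rightarrow> 'v" where
  "Dpow_aux 0 \<kappa> \<alpha> g = g 0"
| "Dpow_aux (Suc n) \<kappa> \<alpha> g =
    (let i = (SOME i. \<alpha> i \<noteq> 0) in Dpow_aux n \<kappa> (\<alpha>(i := \<alpha> i - 1)) (D \<kappa> i g))"

text \<open>The value at the origin of the iterated Dunkl operator with multi-index \<open>\<alpha>\<close>; the order in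
  which the operators are applied is arbitrary, and irrelevant since they commute.\<close>

definition Dpow :: "real \<Rightarrow> ('n \<Rightarrow> nat) \<Rightarrow> (real^'n \<Rightarrow> 'v) \<Rightarrow> 'v" where
  "Dpow \<kappa> \<alpha> = Dpow_aux (mdeg \<alpha>) \<kappa> \<alpha>"

lemma Dpow_0: "Dpow \<kappa> (\<lambda>_. 0) g = g 0"
  by (simp add: Dpow_def mdeg_def)

text \<open>Any operator may be applied first. If the recursion picks some \<open>j\<close> other
  than \<open>i\<close>, both sides reduce by induction to \<open>\<delta>\<close>, which is
  \<open>\<alpha>\<close> lowered at \<open>j\<close>, and there the operators
  \<open>D \<kappa> i\<close> and \<open>D \<kappa> j\<close> can be exchanged.\<close>

lemma Dpow_Suc: "g \<in> Ptau \<Longrightarrow> Dpow \<kappa> (\<alpha>(i := Suc (\<alpha> i))) g = Dpow \<kappa> \<alpha> (D \<kappa> i g)"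
proof (induction "mdeg \<alpha>" arbitrary: \<alpha> i g rule: less_induct)
  case less
  define \<beta> where "\<beta> = \<alpha>(i := Suc (\<alpha> i))"
  define j where "j = (SOME j. \<beta> j \<noteq> 0)"
  have j: "\<beta> j \<noteq> 0"
    unfolding j_def by (rule someI[of _ i]) (simp add: \<beta>_def)
  define \<gamma> where "\<gamma> = \<beta>(j := \<beta> j - 1)"
  have \<gamma>: "\<beta> = \<gamma>(j := Suc (\<gamma> j))" using j by (auto simp: \<gamma>_def)
  have "mdeg \<beta> = Suc (mdeg \<gamma>)" by (subst \<gamma>) (rule mdeg_Suc)
  then have eq: "Dpow \<kappa> \<beta> g = Dpow \<kappa> \<gamma> (D \<kappa> j g)"
    by (simp only: Dpow_def Dpow_aux.simps Let_def j_def[symmetric] \<gamma>_def[symmetric])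
  show ?case
  proof (cases "j = i")
    case True
    then have "\<gamma> = \<alpha>" by (auto simp: \<gamma>_def \<beta>_def)
    then show ?thesis using eq True by (simp add: \<beta>_def)
  next
    case False
    define \<delta> where "\<delta> = \<alpha>(j := \<alpha> j - 1)"
    have \<alpha>: "\<alpha> = \<delta>(j := Suc (\<delta> j))" using j False by (auto simp: \<delta>_def \<beta>_def)
    have \<gamma>': "\<gamma> = \<delta>(i := Suc (\<delta> i))" using False by (auto simp: \<gamma>_def \<delta>_def \<beta>_def)
    have small: "mdeg \<delta> < mdeg \<alpha>" by (metis \<alpha> mdeg_Suc lessI)
    have "Dpow \<kappa> \<beta> g = Dpow \<kappa> \<delta> (D \<kappa> i (D \<kappa> j g))"
      unfolding eq \<gamma>' by (rule less.hyps[OF small]) (intro D_Ptau less.prems)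
    also have "\<dots> = Dpow \<kappa> \<delta> (D \<kappa> j (D \<kappa> i g))"
      by (simp add: D_commute less.prems)
    also have "\<dots> = Dpow \<kappa> (\<delta>(j := Suc (\<delta> j))) (D \<kappa> i g)"
      by (rule less.hyps[OF small, symmetric]) (intro D_Ptau less.prems)
    finally show ?thesis by (simp add: \<beta>_def flip: \<alpha>)
  qed
qed

lemma Dpow_add: "f \<in> Ptau \<Longrightarrow> g \<in> Ptau \<Longrightarrow> Dpow \<kappa> \<alpha> (\<lambda>x. f x + g x) = Dpow \<kappa> \<alpha> f + Dpow \<kappa> \<alpha> g"
  by (induction \<alpha> arbitrary: f g rule: multi_index_induct)
    (simp_all add: Dpow_0 Dpow_Suc Ptau_add D_add D_Ptau)

lemma Dpow_scaleR: "f \<in> Ptau \<Longrightarrow> Dpow \<kappa> \<alpha> (\<lambda>x. a *\<^sub>R f x) = a *\<^sub>R Dpow \<kappa> \<alpha> f"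
  by (induction \<alpha> arbitrary: f rule: multi_index_induct)
    (simp_all add: Dpow_0 Dpow_Suc Ptau_scaleR D_scaleR D_Ptau)

lemma Dpow_zero: "Dpow \<kappa> \<alpha> (\<lambda>x. 0) = 0"
  using Dpow_scaleR[OF Ptau_zero, of \<kappa> \<alpha> 0] by simp

lemma Dpow_sum:
  "(\<And>i. i \<in> I \<Longrightarrow> f i \<in> Ptau) \<Longrightarrow> Dpow \<kappa> \<alpha> (\<lambda>x. \<Sum>i\<in>I. f i x) = (\<Sum>i\<in>I. Dpow \<kappa> \<alpha> (f i))"
  by (induction I rule: infinite_finite_induct) (auto simp: Dpow_zero Dpow_add Ptau_sum)

text \<open>At \<open>\<kappa> = 0\<close> these are iterated partial derivatives at the origin,
  which annihilate every monomial except the one with the same exponents.\<close>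

lemma Dpow_mono: "Dpow 0 \<beta> (mono (\<alpha>, u)) = (if \<alpha> = \<beta> then ifact \<beta> *\<^sub>R u else 0)"
proof (induction \<beta> arbitrary: \<alpha> rule: multi_index_induct)
  case zero
  show ?case by (simp add: Dpow_0 mono_at_0 ifact_def)
next
  case (Suc \<beta> i)
  have "Dpow 0 (\<beta>(i := Suc (\<beta> i))) (mono (\<alpha>, u)) = real (\<alpha> i) *\<^sub>R Dpow 0 \<beta> (mono (\<alpha>(i := \<alpha> i - 1), u))"
    by (simp add: Dpow_Suc mono_Ptau D_0 partial_mono Dpow_scaleR)
  also have "\<dots> = (if \<alpha> = \<beta>(i := Suc (\<beta> i)) then ifact (\<beta>(i := Suc (\<beta> i))) *\<^sub>R u else 0)"
  proof (cases "\<alpha> = \<beta>(i := Suc (\<beta> i))")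
    case True
    then show ?thesis by (simp add: Suc ifact_Suc)
  next
    case False
    then have "\<alpha>(i := \<alpha> i - 1) \<noteq> \<beta>" if "\<alpha> i \<noteq> 0"
      using that by (auto simp: fun_eq_iff split: if_splits)
    then show ?thesis using False by (auto simp: Suc)
  qed
  finally show ?case .
qed

text \<open>The Taylor coefficient at the origin. In this form it depends on the polynomial function
  alone and not on a chosen representation as a sum of monomials.\<close>

definition coef :: "('n \<Rightarrow> nat) \<Rightarrow> (real^'n \<Rightarrow> 'v) \<Rightarrow> 'v" where
  "coef \<alpha> f = (1 / ifact \<alpha>) *\<^sub>R Dpow 0 \<alpha> f"

text \<open>By construction a coordinate factor in the left argument becomes a Dunkl operator on the
  right one; invariance and symmetry have to be proved.\<close>

definition B :: "real \<Rightarrow> (real^'n \<Rightarrow> 'v) \<Rightarrow> (real^'n \<Rightarrow> 'v) \<Rightarrow> real" where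
  "B \<kappa> f g = (\<Sum>\<alpha> | coef \<alpha> f \<noteq> 0. coef \<alpha> f \<bullet> Dpow \<kappa> \<alpha> g)"

lemma coef_sum_mono:
  assumes "finite A"
  shows "coef \<alpha> (\<lambda>x. \<Sum>\<alpha>\<in>A. mono (\<alpha>, c \<alpha>) x) = (if \<alpha> \<in> A then c \<alpha> else 0)"
proof -
  have "Dpow 0 \<alpha> (\<lambda>x. \<Sum>\<alpha>\<in>A. mono (\<alpha>, c \<alpha>) x) = (\<Sum>\<beta>\<in>A. if \<beta> = \<alpha> then ifact \<alpha> *\<^sub>R c \<beta> else 0)"
    by (subst Dpow_sum) (auto simp: mono_Ptau Dpow_mono intro!: sum.cong)
  also have "\<dots> = (if \<alpha> \<in> A then ifact \<alpha> *\<^sub>R c \<alpha> else 0)"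
    using assms by simp
  finally show ?thesis by (simp add: coef_def ifact_nonzero)
qed

lemma coef_add: "f \<in> Ptau \<Longrightarrow> g \<in> Ptau \<Longrightarrow> coef \<alpha> (\<lambda>x. f x + g x) = coef \<alpha> f + coef \<alpha> g"
  by (simp add: coef_def Dpow_add algebra_simps)

lemma coef_scaleR: "f \<in> Ptau \<Longrightarrow> coef \<alpha> (\<lambda>x. a *\<^sub>R f x) = a *\<^sub>R coef \<alpha> f"
  by (simp add: coef_def Dpow_scaleR)

lemma finite_coef: "f \<in> Ptau \<Longrightarrow> finite {\<alpha>. coef \<alpha> f \<noteq> 0}"
  by (erule PtauE) (auto simp: coef_sum_mono)

lemma B_superset:
  "finite A \<Longrightarrow> {\<alpha>. coef \<alpha> f \<noteq> 0} \<subseteq> A \<Longrightarrow> B \<kappa> f g = (\<Sum>\<alpha>\<in>A. coef \<alpha> f \<bullet> Dpow \<kappa> \<alpha> g)"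
  unfolding B_def by (rule sum.mono_neutral_left) auto

lemma B_add_left:
  assumes "f1 \<in> Ptau" "f2 \<in> Ptau"
  shows "B \<kappa> (\<lambda>x. f1 x + f2 x) g = B \<kappa> f1 g + B \<kappa> f2 g"
proof -
  let ?A = "{\<alpha>. coef \<alpha> f1 \<noteq> 0} \<union> {\<alpha>. coef \<alpha> f2 \<noteq> 0}"
  have A: "finite ?A" using assms by (simp add: finite_coef)
  have "B \<kappa> (\<lambda>x. f1 x + f2 x) g = (\<Sum>\<alpha>\<in>?A. coef \<alpha> (\<lambda>x. f1 x + f2 x) \<bullet> Dpow \<kappa> \<alpha> g)"
    by (rule B_superset[OF A]) (auto simp: coef_add assms)
  also have "\<dots> = (\<Sum>\<alpha>\<in>?A. coef \<alpha> f1 \<bullet> Dpow \<kappa> \<alpha> g) + (\<Sum>\<alpha>\<in>?A. coef \<alpha> f2 \<bullet> Dpow \<kappa> \<alpha> g)"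
    by (simp add: coef_add assms inner_add_left sum.distrib)
  also have "\<dots> = B \<kappa> f1 g + B \<kappa> f2 g"
    by (intro arg_cong2[where f = "(+)"] B_superset[OF A, symmetric]) auto
  finally show ?thesis .
qed

lemma B_scaleR_left:
  assumes "f \<in> Ptau"
  shows "B \<kappa> (\<lambda>x. a *\<^sub>R f x) g = a * B \<kappa> f g"
proof -
  have "B \<kappa> (\<lambda>x. a *\<^sub>R f x) g = (\<Sum>\<alpha> | coef \<alpha> f \<noteq> 0. coef \<alpha> (\<lambda>x. a *\<^sub>R f x) \<bullet> Dpow \<kappa> \<alpha> g)"
    by (rule B_superset[OF finite_coef[OF assms]]) (auto simp: coef_scaleR assms)
  then show ?thesis by (simp add: coef_scaleR assms B_def sum_distrib_left)
qed

lemma B_zero_left: "B \<kappa> (\<lambda>x. 0) g = 0"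
  using B_scaleR_left[OF Ptau_zero, of \<kappa> 0] by simp

lemma B_sum_left:
  "(\<And>i. i \<in> I \<Longrightarrow> f i \<in> Ptau) \<Longrightarrow> B \<kappa> (\<lambda>x. \<Sum>i\<in>I. f i x) g = (\<Sum>i\<in>I. B \<kappa> (f i) g)"
  by (induction I rule: infinite_finite_induct) (auto simp: B_zero_left B_add_left Ptau_sum)

lemma B_add_right:
  "g1 \<in> Ptau \<Longrightarrow> g2 \<in> Ptau \<Longrightarrow> B \<kappa> f (\<lambda>x. g1 x + g2 x) = B \<kappa> f g1 + B \<kappa> f g2"
  by (simp add: B_def Dpow_add inner_add_right sum.distrib)

lemma B_scaleR_right: "g \<in> Ptau \<Longrightarrow> B \<kappa> f (\<lambda>x. a *\<^sub>R g x) = a * B \<kappa> f g"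
  by (simp add: B_def Dpow_scaleR sum_distrib_left)

lemma B_zero_right: "B \<kappa> f (\<lambda>x. 0) = 0"
  by (simp add: B_def Dpow_zero)

lemma B_sum_right:
  "(\<And>i. i \<in> I \<Longrightarrow> g i \<in> Ptau) \<Longrightarrow> B \<kappa> f (\<lambda>x. \<Sum>i\<in>I. g i x) = (\<Sum>i\<in>I. B \<kappa> f (g i))"
  by (induction I rule: infinite_finite_induct) (auto simp: B_zero_right B_add_right Ptau_sum)

lemma B_mono: "B \<kappa> (mono (\<alpha>, u)) g = u \<bullet> Dpow \<kappa> \<alpha> g"
proof -
  have coef: "coef \<beta> (mono (\<alpha>, u)) = (if \<beta> \<in> {\<alpha>} then u else 0)" for \<beta>
    using coef_sum_mono[of "{\<alpha>}" \<beta> "\<lambda>_. u"] by simp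
  have "B \<kappa> (mono (\<alpha>, u)) g = (\<Sum>\<beta>\<in>{\<alpha>}. coef \<beta> (mono (\<alpha>, u)) \<bullet> Dpow \<kappa> \<beta> g)"
    by (rule B_superset) (auto simp: coef split: if_splits)
  then show ?thesis by (simp add: coef)
qed

lemma B_const: "B \<kappa> (\<lambda>x. u) g = u \<bullet> g 0"
  using B_mono[of \<kappa> "\<lambda>_. 0" u g] by (simp add: mono_0 Dpow_0)

section \<open>Adjointness, invariance, symmetry and orthogonality\<close>

lemma B_axis_left:
  assumes "f \<in> Ptau" "g \<in> Ptau"
  shows "B \<kappa> (mulX (axis i 1) f) g = B \<kappa> f (D \<kappa> i g)"
proof -
  obtain A c where "finite A" and f: "f = (\<lambda>x. \<Sum>\<alpha>\<in>A. mono (\<alpha>, c \<alpha>) x)"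
    using assms(1) by (rule PtauE)
  have "mulX (axis i 1) f = (\<lambda>x. \<Sum>\<alpha>\<in>A. mono (\<alpha>(i := Suc (\<alpha> i)), c \<alpha>) x)"
    by (simp add: mulX_axis f scaleR_sum_right mono_Suc)
  then have "B \<kappa> (mulX (axis i 1) f) g = (\<Sum>\<alpha>\<in>A. B \<kappa> (mono (\<alpha>(i := Suc (\<alpha> i)), c \<alpha>)) g)"
    by (simp add: B_sum_left mono_Ptau)
  also have "\<dots> = (\<Sum>\<alpha>\<in>A. B \<kappa> (mono (\<alpha>, c \<alpha>)) (D \<kappa> i g))"
    by (simp add: B_mono Dpow_Suc assms(2))
  also have "\<dots> = B \<kappa> f (D \<kappa> i g)"
    by (simp add: f B_sum_left mono_Ptau)
  finally show ?thesis .
qed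

lemma B_mulX_left:
  assumes "f \<in> Ptau" "g \<in> Ptau"
  shows "B \<kappa> (mulX z f) g = B \<kappa> f (DD \<kappa> z g)"
proof -
  have "mulX z f = (\<lambda>x. \<Sum>i\<in>UNIV. z$i *\<^sub>R mulX (axis i 1) f x)"
    by (rule ext, rule mulX_expand)
  then have "B \<kappa> (mulX z f) g = (\<Sum>i\<in>UNIV. z$i * B \<kappa> (mulX (axis i 1) f) g)"
    using assms by (simp add: B_sum_left B_scaleR_left Ptau_scaleR Ptau_mulX)
  then show ?thesis
    using assms by (simp add: DD_def B_axis_left B_sum_right B_scaleR_right Ptau_scaleR D_Ptau)
qed

text \<open>A linear factor of the first argument becomes a Dunkl operator on the second, and
  equivariance lets the reflection pass it. For constants it remains that reflections fix the origin
  and that \<open>\<tau>\<close> is orthogonal.\<close>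

lemma B_reflection_invariant:
  assumes "f \<in> Ptau" "g \<in> Ptau" "r \<in> R"
  shows "B \<kappa> (s r f) (s r g) = B \<kappa> f g"
  using assms(1,2)
proof (induction arbitrary: g rule: Ptau_induct)
  case (const u)
  have "rfl r 0 = 0" by (simp add: rfl_def)
  then show ?case
    using assms(3) by (simp add: s_const B_const s_apply rep_inner refl_mat_reflgroup)
next
  case (add f1 f2)
  then show ?case using assms(3) by (simp add: s_add B_add_left s_Ptau)
next
  case (mulX z f)
  have "B \<kappa> (s r (mulX z f)) (s r g) = B \<kappa> (s r f) (DD \<kappa> (rfl r z) (s r g))"
    using mulX assms(3) by (simp add: s_mulX B_mulX_left s_Ptau)
  also have "\<dots> = B \<kappa> (s r f) (s r (DD \<kappa> z g))"
    using mulX assms(3) by (simp add: DD_equivariant)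
  also have "\<dots> = B \<kappa> (mulX z f) g"
    using mulX by (simp add: B_mulX_left DD_Ptau)
  finally show ?case .
qed

lemma B_reflection_adjoint:
  assumes "f \<in> Ptau" "g \<in> Ptau" "r \<in> R"
  shows "B \<kappa> f (s r g) = B \<kappa> (s r f) g"
  using B_reflection_invariant[OF assms(1) s_Ptau[OF assms(3,2)] assms(3)] s_s[OF assms(3)] by simp

text \<open>Peeling a factor \<open>mulX u\<close> off the first argument brings the commutation
  relation into play on \<open>g\<close>. The induction hypothesis and the self-adjointness of
  reflections carry each term to the left argument, where the symmetry of \<open>rcoef\<close>
  reassembles the same relation.\<close>

lemma B_mulX_right:
  assumes "f \<in> Ptau" "g \<in> Ptau"
  shows "B \<kappa> f (mulX z g) = B \<kappa> (DD \<kappa> z f) g"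
  using assms
proof (induction arbitrary: g rule: Ptau_induct)
  case (const u)
  then show ?case by (simp add: B_const DD_const B_zero_left mulX_def)
next
  case (add f1 f2)
  then show ?case by (simp add: B_add_left DD_add DD_Ptau)
next
  case (mulX u f)
  have sP: "s v f \<in> Ptau" "s v g \<in> Ptau" if "v \<in> Rp" for v
    using that mulX by (auto intro: s_Ptau Rp_root)
  have "B \<kappa> (mulX u f) (mulX z g) = B \<kappa> f (DD \<kappa> u (mulX z g))"
    using mulX by (simp add: B_mulX_left Ptau_mulX)
  also have "\<dots> = B \<kappa> f (mulX z (DD \<kappa> u g)) + (u \<bullet> z) * B \<kappa> f g
      + \<kappa> * (\<Sum>v\<in>Rp. rcoef v u z * B \<kappa> f (s v g))"
    using mulX sP by (simp add: DD_mulX B_add_right B_scaleR_right B_sum_right Ptau_add Ptau_scaleR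
        Ptau_sum Ptau_mulX DD_Ptau)
  also have "B \<kappa> f (mulX z (DD \<kappa> u g)) = B \<kappa> (mulX u (DD \<kappa> z f)) g"
    using mulX by (simp add: DD_Ptau B_mulX_left)
  also have "(\<Sum>v\<in>Rp. rcoef v u z * B \<kappa> f (s v g)) = (\<Sum>v\<in>Rp. rcoef v z u * B \<kappa> (s v f) g)"
    using mulX by (intro sum.cong refl) (simp add: B_reflection_adjoint Rp_root rcoef_commute)
  also have "B \<kappa> (mulX u (DD \<kappa> z f)) g + (u \<bullet> z) * B \<kappa> f g
      + \<kappa> * (\<Sum>v\<in>Rp. rcoef v z u * B \<kappa> (s v f) g) = B \<kappa> (DD \<kappa> z (mulX u f)) g"
    using mulX sP by (simp add: DD_mulX B_add_left B_scaleR_left B_sum_left Ptau_add Ptau_scaleR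
        Ptau_sum Ptau_mulX DD_Ptau inner_commute)
  finally show ?case .
qed

lemma B_const_right: "g \<in> Ptau \<Longrightarrow> B \<kappa> g (\<lambda>x. u) = u \<bullet> g 0"
proof (induction rule: Ptau_induct)
  case (mulX z g)
  then show ?case by (simp add: B_mulX_left Ptau_const DD_const B_zero_right) (simp add: mulX_def)
qed (auto simp: B_const B_add_left inner_commute inner_add_right)

text \<open>Multiplication is adjoint to the Dunkl operator from either side, so the induction comes
  down to a constant argument, where both orders evaluate the other argument at the origin.\<close>

lemma B_sym:
  assumes "f \<in> Ptau" "g \<in> Ptau"
  shows "B \<kappa> f g = B \<kappa> g f"
  using assms
proof (induction arbitrary: g rule: Ptau_induct)
  case (mulX z f)
  then show ?case by (simp add: B_mulX_left B_mulX_right DD_Ptau)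
qed (auto simp: B_const B_const_right B_add_left B_add_right)

text \<open>Moving a linear factor across lowers both degrees by one. This goes on until one
  argument is constant, and constants are orthogonal to positive degrees.\<close>

lemma B_orthogonal: "f \<in> Phom m \<Longrightarrow> g \<in> Phom n \<Longrightarrow> m \<noteq> n \<Longrightarrow> B \<kappa> f g = 0"
proof (induction arbitrary: g n rule: Phom_induct)
  case (const u)
  then show ?case by (simp add: B_const Phom_at_0)
next
  case (add m f1 f2)
  then have "f1 \<in> Ptau" "f2 \<in> Ptau" by (auto intro: Phom_Ptau)
  with add show ?case by (simp add: B_add_left)
next
  case (mulX m z f)
  then have P: "f \<in> Ptau" "g \<in> Ptau" by (auto intro: Phom_Ptau)
  show ?case
  proof (cases n)
    case 0
    then obtain u where "g = (\<lambda>x. u)" using Phom_0_const mulX.prems(1) by blast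
    then show ?thesis using P by (simp add: B_mulX_left DD_const B_zero_right)
  next
    case (Suc k)
    have "DD \<kappa> z g \<in> Phom k"
      using D_Phom[OF mulX.prems(1)] unfolding DD_def Suc by (intro Phom_sum Phom_scaleR) simp
    then show ?thesis using mulX P Suc by (simp add: B_mulX_left)
  qed
qed

lemma B_group_invariant:
  assumes "w \<in> reflgroup R" "f \<in> Ptau" "g \<in> Ptau"
  shows "B \<kappa> (Wact \<tau> w f) (Wact \<tau> w g) = B \<kappa> f g"
  using assms(1)
proof induction
  case one
  show ?case by (simp add: Wact_one)
next
  case (step v w)
  then show ?case using assms(2,3)
    by (simp add: Wact_mult refl_mat_reflgroup B_reflection_invariant Wact_Ptau)
qed

section \<open>Existence, uniqueness and continuity of the form\<close>

definition kB :: "real \<Rightarrow> (real^'n \<Rightarrow> 'v) \<Rightarrow> (real^'n \<Rightarrow> 'v) \<Rightarrow> real" where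
  "kB \<kappa> f g = (if f \<in> Ptau \<and> g \<in> Ptau then B \<kappa> f g else 0)"

lemma is_kform_kB: "is_kform R Rp \<tau> \<kappa> (kB \<kappa>)"
  unfolding is_kform_def
proof (intro conjI allI ballI impI)
  fix f1 f2 g :: "real^'n \<Rightarrow> 'v" and a b :: real
  assume "f1 \<in> Ptau" "f2 \<in> Ptau" "g \<in> Ptau"
  then show "kB \<kappa> (\<lambda>x. a *\<^sub>R f1 x + b *\<^sub>R f2 x) g = a * kB \<kappa> f1 g + b * kB \<kappa> f2 g"
    by (simp add: kB_def Ptau_add Ptau_scaleR B_add_left B_scaleR_left)
next
  fix i and f g :: "real^'n \<Rightarrow> 'v" assume "f \<in> Ptau" "g \<in> Ptau"
  then show "kB \<kappa> (D \<kappa> i f) g = kB \<kappa> f (\<lambda>x. x$i *\<^sub>R g x)"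
    using B_mulX_right[of f g \<kappa> "axis i 1"] Ptau_mulX[of g "axis i 1"]
    by (simp add: kB_def D_Ptau DD_axis mulX_axis)
next
  fix m n and f g :: "real^'n \<Rightarrow> 'v"
  assume "m \<noteq> n \<and> f \<in> Phom m \<and> g \<in> Phom n"
  then show "kB \<kappa> f g = 0" by (auto simp: kB_def intro: B_orthogonal)
qed (auto simp: kB_def B_sym B_const Ptau_const B_group_invariant Wact_Ptau)

text \<open>Adjointness and symmetry trade each linear factor of the first argument for a Dunkl
  operator on the second, so any such form reduces to its values on constants in the same way as
  \<open>B \<kappa>\<close>.\<close>

lemma is_kform_unique:
  assumes B': "is_kform R Rp \<tau> \<kappa> B'" and f: "f \<in> Ptau" and g: "g \<in> Ptau"
  shows "B' f g = B \<kappa> f g"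
proof -
  note ax1 = B'[unfolded is_kform_def]
  note ax2 = ax1[THEN conjunct2]
  note ax3 = ax2[THEN conjunct2]
  note ax6 = ax3[THEN conjunct2, THEN conjunct2, THEN conjunct2]
  have lin: "B' (\<lambda>x. a *\<^sub>R f1 x + b *\<^sub>R f2 x) g = a * B' f1 g + b * B' f2 g"
    if "f1 \<in> Ptau" "f2 \<in> Ptau" "g \<in> Ptau" for f1 f2 g a b
    using ax1[THEN conjunct1] that by simp
  have sym: "B' f g = B' g f" if "f \<in> Ptau" "g \<in> Ptau" for f g
    using ax2[THEN conjunct1] that by simp
  have const: "B' (\<lambda>x. u1) (\<lambda>x. u2) = u1 \<bullet> u2" for u1 u2
    using ax3[THEN conjunct1] by simp
  have adj: "B' (D \<kappa> i f) g = B' f (mulX (axis i 1) g)" if "f \<in> Ptau" "g \<in> Ptau" for i f g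
    using ax6 that by (simp add: mulX_axis)
  have add': "B' (\<lambda>x. f1 x + f2 x) g = B' f1 g + B' f2 g"
    if "f1 \<in> Ptau" "f2 \<in> Ptau" "g \<in> Ptau" for f1 f2 g
    using lin[OF that, of 1 1] by simp
  have scale: "B' (\<lambda>x. a *\<^sub>R f x) g = a * B' f g" if "f \<in> Ptau" "g \<in> Ptau" for f g a
    using lin[OF that(1,1,2), of a 0] by simp
  have zero: "B' (\<lambda>x. 0) g = 0" if "g \<in> Ptau" for g
    using scale[OF Ptau_zero that, of 0] by simp
  have sum: "B' (\<lambda>x. \<Sum>i\<in>I. z i *\<^sub>R h i x) g = (\<Sum>i\<in>I. z i * B' (h i) g)"
    if "\<And>i. i \<in> I \<Longrightarrow> h i \<in> Ptau" "g \<in> Ptau" for I :: "'n set" and z h g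
    using that by (induction I rule: infinite_finite_induct)
      (auto simp: zero add' scale Ptau_sum Ptau_scaleR)
  have mulX': "B' (mulX z g) f = B' (DD \<kappa> z f) g" if "f \<in> Ptau" "g \<in> Ptau" for z f g
  proof -
    have "mulX z g = (\<lambda>x. \<Sum>i\<in>UNIV. z$i *\<^sub>R mulX (axis i 1) g x)"
      by (rule ext, rule mulX_expand)
    then have "B' (mulX z g) f = (\<Sum>i\<in>UNIV. z$i * B' (mulX (axis i 1) g) f)"
      using that by (simp add: sum Ptau_mulX)
    also have "\<dots> = (\<Sum>i\<in>UNIV. z$i * B' (D \<kappa> i f) g)"
      using that by (simp add: adj sym[of _ f] Ptau_mulX)
    also have "\<dots> = B' (DD \<kappa> z f) g"
      using that by (simp add: DD_def sum D_Ptau)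
    finally show ?thesis .
  qed
  \<comment> \<open>Against a constant, a linear factor of \<open>g\<close> becomes a Dunkl operator
    that kills the constant.\<close>
  have const_right: "B' g (\<lambda>x. u) = B \<kappa> g (\<lambda>x. u)" if "g \<in> Ptau" for g u
    using that
  proof (induction rule: Ptau_induct)
    case (mulX z g)
    then show ?case
      by (simp add: mulX' Ptau_const DD_const zero B_mulX_left B_zero_right)
  qed (auto simp: const B_const add' B_add_left Ptau_const)
  show ?thesis
    using f g
  proof (induction arbitrary: g rule: Ptau_induct)
    case (const u)
    then show ?case by (simp add: const_right sym[of _ g] B_sym[of _ g] Ptau_const)
  next
    case (add f1 f2)
    then show ?case
      by (simp add: add' B_add_left)
  next
    case (mulX z f)
    then show ?case
      by (simp add: mulX' sym[of _ f] DD_Ptau B_mulX_left)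
  qed
qed

lemma kform_eq: "f \<in> Ptau \<Longrightarrow> g \<in> Ptau \<Longrightarrow> kform R Rp \<tau> \<kappa> f g = B \<kappa> f g"
proof -
  have "kform R Rp \<tau> \<kappa> = kB \<kappa>"
    unfolding kform_def
  proof (rule the_equality)
    show "is_kform R Rp \<tau> \<kappa> (kB \<kappa>) \<and> (\<forall>f g. \<not> (f \<in> Ptau \<and> g \<in> Ptau) \<longrightarrow> kB \<kappa> f g = 0)"
      by (auto simp: is_kform_kB kB_def)
    fix B' assume "is_kform R Rp \<tau> \<kappa> B' \<and> (\<forall>f g. \<not> (f \<in> Ptau \<and> g \<in> Ptau) \<longrightarrow> B' f g = 0)"
    then show "B' = kB \<kappa>" by (intro ext) (auto simp: kB_def is_kform_unique)
  qed
  then show "f \<in> Ptau \<Longrightarrow> g \<in> Ptau \<Longrightarrow> kform R Rp \<tau> \<kappa> f g = B \<kappa> f g"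
    by (simp add: kB_def)
qed

text \<open>The operators are affine in \<open>\<kappa>\<close>; their values at \<open>0\<close>
  and \<open>1\<close> express both coefficients.\<close>

lemma DD_affine: "DD \<kappa> z g = (\<lambda>x. DD 0 z g x + \<kappa> *\<^sub>R (DD 1 z g x - DD 0 z g x))"
  by (simp add: DD_def Dunkl_def scaleR_add_right sum.distrib scaleR_sum_right mult_ac)

text \<open>A linear factor on the left contributes an operator affine in \<open>\<kappa>\<close>,
  with slope \<open>h\<close> when applied to \<open>g\<close>. Since \<open>DD 0 z g\<close> and
  \<open>h\<close> do not depend on \<open>\<kappa>\<close>, the induction hypothesis applies to
  both.\<close>

lemma continuous_B: "f \<in> Ptau \<Longrightarrow> g \<in> Ptau \<Longrightarrow> continuous_on UNIV (\<lambda>\<kappa>. B \<kappa> f g)"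
proof (induction arbitrary: g rule: Ptau_induct)
  case (mulX z f)
  define h where "h = (\<lambda>x. DD 1 z g x + (-1) *\<^sub>R DD 0 z g x)"
  have P: "DD 0 z g \<in> Ptau" "h \<in> Ptau"
    unfolding h_def by (intro Ptau_add Ptau_scaleR DD_Ptau mulX.prems)+
  have "B \<kappa> (mulX z f) g = B \<kappa> f (DD 0 z g) + \<kappa> * B \<kappa> f h" for \<kappa>
  proof -
    have "B \<kappa> (mulX z f) g = B \<kappa> f (\<lambda>x. DD 0 z g x + \<kappa> *\<^sub>R h x)"
      using mulX by (simp add: B_mulX_left DD_affine[of \<kappa>] h_def)
    then show ?thesis using P by (simp add: B_add_right B_scaleR_right Ptau_scaleR)
  qed
  then show ?case using mulX.IH P by (auto intro!: continuous_intros)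
qed (auto simp: B_const B_add_left intro!: continuous_intros)

end

section \<open>Degeneration of the form\<close>

context dunkl
begin

definition degenerate :: "real \<Rightarrow> nat \<Rightarrow> bool" where
  "degenerate \<kappa> n \<longleftrightarrow> (\<exists>f\<in>Phom n. f \<noteq> (\<lambda>x. 0) \<and> (\<forall>g\<in>Phom n. B \<kappa> f g = 0))"

definition posdef :: "real \<Rightarrow> nat \<Rightarrow> bool" where
  "posdef \<kappa> n \<longleftrightarrow> (\<forall>f\<in>Phom n. f \<noteq> (\<lambda>x. 0) \<longrightarrow> B \<kappa> f f > 0)"

lemma posdef_degree_0: "posdef \<kappa> 0"
  unfolding posdef_def by (auto dest!: Phom_0_const simp: B_const)

text \<open>At \<open>\<kappa> = 0\<close> Euler's identity expresses the form in degree \<open>n + 1\<close> by the form in degree \<open>n\<close>.\<close>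

lemma posdef_at_0: "posdef 0 n"
proof (induction n)
  case (Suc n)
  show ?case
    unfolding posdef_def
  proof (intro ballI impI)
    fix f :: "real^'n \<Rightarrow> 'v" assume f: "f \<in> Phom (Suc n)" "f \<noteq> (\<lambda>x. 0)"
    have fP: "f \<in> Ptau" by (rule Phom_Ptau[OF f(1)])
    have eu: "(\<Sum>i\<in>UNIV. mulX (axis i 1) (D 0 i f) x) = real (Suc n) *\<^sub>R f x" for x
      using euler[OF f(1), of x 0] by (simp add: mulX_axis)
    have "real (Suc n) * B 0 f f = B 0 (\<lambda>x. real (Suc n) *\<^sub>R f x) f"
      by (simp add: B_scaleR_left fP)
    also have "\<dots> = (\<Sum>i\<in>UNIV. B 0 (D 0 i f) (D 0 i f))"
      unfolding eu[symmetric] by (simp add: B_sum_left Ptau_mulX D_Ptau fP B_axis_left)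
    also have "\<dots> > 0"
    proof -
      have D: "D 0 i f \<in> Phom n" for i using D_Phom[OF f(1)] by simp
      have "\<exists>i. D 0 i f \<noteq> (\<lambda>x. 0)"
      proof (rule ccontr)
        assume "\<nexists>i. D 0 i f \<noteq> (\<lambda>x. 0)"
        then have "real (Suc n) *\<^sub>R f x = 0" for x
          using eu[of x] by (simp add: mulX_axis)
        with f(2) show False by auto
      qed
      then obtain i where i: "D 0 i f \<noteq> (\<lambda>x. 0)" by blast
      have nn: "B 0 (D 0 j f) (D 0 j f) \<ge> 0" for j
        using Suc D[of j] by (cases "D 0 j f = (\<lambda>x. 0)") (auto simp: posdef_def B_zero_left less_imp_le)
      have "B 0 (D 0 i f) (D 0 i f) > 0" using Suc D[of i] i by (simp add: posdef_def)
      then show ?thesis using nn by (intro sum_pos2[of _ i]) auto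
    qed
    finally show "B 0 f f > 0" by (simp add: zero_less_mult_iff)
  qed
qed (rule posdef_degree_0)

lemma posdef_not_degenerate: "posdef \<kappa> n \<Longrightarrow> \<not> degenerate \<kappa> n"
  unfolding posdef_def degenerate_def by force

text \<open>A coordinate multiple of a radical vector pairs with \<open>g\<close> as the vector
  itself pairs with \<open>D \<kappa> i g\<close>, which has degree \<open>n\<close>. It is nonzero
  because a polynomial vanishing off a hyperplane is zero.\<close>

lemma degenerate_Suc:
  assumes "degenerate \<kappa> n"
  shows "degenerate \<kappa> (Suc n)"
proof -
  obtain f where f: "f \<in> Phom n" "f \<noteq> (\<lambda>x. 0)" "\<And>g. g \<in> Phom n \<Longrightarrow> B \<kappa> f g = 0"
    using assms by (auto simp: degenerate_def)
  \<comment> \<open>Any coordinate will do.\<close>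
  define i :: 'n where "i = undefined"
  let ?F = "mulX (axis i 1) f"
  have "?F \<in> Phom (Suc n)" by (rule Phom_mulX[OF f(1)])
  moreover have "?F \<noteq> (\<lambda>x. 0)"
  proof
    assume 0: "?F = (\<lambda>x. 0)"
    have "f x = 0" if "x \<bullet> axis i 1 \<noteq> 0" for x
      using fun_cong[OF 0, of x] that by (simp add: mulX_def)
    then have "f = (\<lambda>x. 0)"
      by (intro Ptau_eq_off_hyperplane[of f "\<lambda>x. 0" "axis i 1"]) (auto simp: Phom_Ptau[OF f(1)])
    with f(2) show False by simp
  qed
  moreover have "B \<kappa> ?F g = 0" if "g \<in> Phom (Suc n)" for g
    using f(3) D_Phom[OF that] by (simp add: B_axis_left Phom_Ptau[OF f(1)] Phom_Ptau[OF that])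
  ultimately show ?thesis unfolding degenerate_def by blast
qed

text \<open>For radical \<open>f\<close>, the value of the form at \<open>D \<kappa> i f\<close> is
  the pairing of \<open>f\<close> with a polynomial of degree \<open>n + 1\<close>, hence zero;
  definiteness in degree \<open>n\<close> does the rest.\<close>

lemma degenerate_singular:
  assumes "degenerate \<kappa> (Suc n)" "posdef \<kappa> n"
  obtains f where "f \<in> Phom (Suc n)" "f \<noteq> (\<lambda>x. 0)" "\<And>i. D \<kappa> i f = (\<lambda>x. 0)"
proof -
  obtain f where f: "f \<in> Phom (Suc n)" "f \<noteq> (\<lambda>x. 0)" "\<And>g. g \<in> Phom (Suc n) \<Longrightarrow> B \<kappa> f g = 0"
    using assms(1) by (auto simp: degenerate_def)
  have fP: "f \<in> Ptau" by (rule Phom_Ptau[OF f(1)])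
  have "D \<kappa> i f = (\<lambda>x. 0)" for i
  proof (rule ccontr)
    assume n: "D \<kappa> i f \<noteq> (\<lambda>x. 0)"
    have D: "D \<kappa> i f \<in> Phom n" using D_Phom[OF f(1)] by simp
    have "B \<kappa> (D \<kappa> i f) (D \<kappa> i f) = B \<kappa> f (mulX (axis i 1) (D \<kappa> i f))"
      by (simp add: B_mulX_right fP D_Ptau DD_axis)
    also have "\<dots> = 0" by (intro f(3) Phom_mulX D)
    finally show False using assms(2) D n by (auto simp: posdef_def)
  qed
  with f that show ?thesis by blast
qed

text \<open>Evaluate Euler's identity at a point of a sphere where \<open>norm (f x)\<close> is largest.\<close>

lemma singular_degree_bound:
  assumes f: "f \<in> Phom n" "f \<noteq> (\<lambda>x. 0)" and sing: "\<And>i. D \<kappa> i f = (\<lambda>x. 0)"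
  shows "real n \<le> 2 * \<bar>\<kappa>\<bar> * real (card Rp)"
proof -
  obtain x0 where x0: "f x0 \<noteq> 0" using f(2) by blast
  have "continuous_on (sphere 0 (norm x0)) (\<lambda>x. norm (f x))"
    by (intro continuous_on_norm continuous_on_subset[OF Ptau_continuous[OF Phom_Ptau[OF f(1)]]]) simp
  then obtain x where x: "norm x = norm x0" "\<And>y. norm y = norm x0 \<Longrightarrow> norm (f y) \<le> norm (f x)"
    using continuous_attains_sup[of "sphere 0 (norm x0)" "\<lambda>x. norm (f x)"] by auto
  have pos: "norm (f x) > 0" using x(2)[of x0] x0 by (metis less_le_trans zero_less_norm_iff)
  have term_le: "norm (\<tau> (refl_mat v) (f x) - s v f x) \<le> 2 * norm (f x)" if "v \<in> Rp" for v
  proof -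
    have "norm (f (rfl v x)) \<le> norm (f x)"
      using that x by (intro x(2)) (simp add: norm_rfl Rp_nonzero)
    then have "norm (\<tau> (refl_mat v) (f x)) + norm (s v f x) \<le> 2 * norm (f x)"
      using that by (simp add: norm_rep refl_mat_reflgroup Rp_root s_apply)
    then show ?thesis using norm_triangle_ineq4 order_trans by blast
  qed
  have "real n *\<^sub>R f x = - (\<kappa> *\<^sub>R (\<Sum>v\<in>Rp. \<tau> (refl_mat v) (f x) - s v f x))"
    using euler[OF f(1), of x \<kappa>] by (simp add: sing eq_neg_iff_add_eq_0)
  then have "norm (real n *\<^sub>R f x) = norm (- (\<kappa> *\<^sub>R (\<Sum>v\<in>Rp. \<tau> (refl_mat v) (f x) - s v f x)))"
    by simp
  then have "real n * norm (f x) = \<bar>\<kappa>\<bar> * norm (\<Sum>v\<in>Rp. \<tau> (refl_mat v) (f x) - s v f x)"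
    by simp
  also have "\<dots> \<le> \<bar>\<kappa>\<bar> * (\<Sum>v\<in>Rp. 2 * norm (f x))"
    by (intro mult_left_mono order_trans[OF norm_sum] sum_mono term_le) auto
  also have "\<dots> = (2 * \<bar>\<kappa>\<bar> * real (card Rp)) * norm (f x)" by simp
  finally show ?thesis using pos by (simp add: mult_le_cancel_right)
qed

lemma coef_mono: "coef \<alpha> (mono p) = (if fst p = \<alpha> then snd p else 0)"
  using Dpow_mono[of \<alpha> "fst p" "snd p"] by (simp add: coef_def ifact_nonzero)

end

section \<open>Gram matrices and the first degenerate parameter\<close>

locale dunkl_basis = dunkl R Rp \<tau>
  for R Rp :: "(real^'n::finite) set" and \<tau> :: "real^'n^'n \<Rightarrow> 'v::euclidean_space \<Rightarrow> 'v" +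
  fixes us :: "'v list" and ord :: "nat \<Rightarrow> (('n \<Rightarrow> nat) \<times> 'v) list"
  assumes basis: "vbasis us"
    and ord: "\<And>n. 1 \<le> n \<Longrightarrow> distinct (ord n)"
      "\<And>n. 1 \<le> n \<Longrightarrow> set (ord n) = {\<alpha>. mdeg \<alpha> = n} \<times> set us"
begin

definition comb :: "nat \<Rightarrow> (nat \<Rightarrow> real) \<Rightarrow> real^'n \<Rightarrow> 'v" where
  "comb n x = (\<lambda>y. \<Sum>j<length (ord n). x j *\<^sub>R mono (ord n ! j) y)"

lemma comb_eq_sum:
  assumes "1 \<le> n" "\<And>j. j < length (ord n) \<Longrightarrow> b (ord n ! j) = x j"
  shows "comb n x = (\<lambda>y. \<Sum>p\<in>set (ord n). b p *\<^sub>R mono p y)"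
proof
  fix y
  have "bij_betw ((!) (ord n)) {..<length (ord n)} (set (ord n))"
    by (rule bij_betw_nth) (use ord assms in auto)
  from sum.reindex_bij_betw[OF this, of "\<lambda>p. b p *\<^sub>R mono p y"]
  show "comb n x y = (\<Sum>p\<in>set (ord n). b p *\<^sub>R mono p y)"
    by (simp add: comb_def assms)
qed

lemma mono_ord_Phom:
  assumes "1 \<le> n" "j < length (ord n)"
  shows "mono (ord n ! j) \<in> Phom n"
proof -
  have "ord n ! j \<in> {\<alpha>. mdeg \<alpha> = n} \<times> set us"
    unfolding ord(2)[OF assms(1), symmetric] by (rule nth_mem[OF assms(2)])
  then show ?thesis using mono_Phom[of "fst (ord n ! j)" "snd (ord n ! j)"] by auto
qed

lemma comb_Phom: "1 \<le> n \<Longrightarrow> comb n x \<in> Phom n"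
  unfolding comb_def by (intro Phom_sum Phom_scaleR mono_ord_Phom) auto

lemma comb_surj:
  assumes "f \<in> Phom n" "1 \<le> n"
  obtains x where "f = comb n x"
proof -
  obtain A c where A: "finite A" "\<And>\<alpha>. \<alpha> \<in> A \<Longrightarrow> mdeg \<alpha> = n" and f: "f = (\<lambda>y. \<Sum>\<alpha>\<in>A. mono (\<alpha>, c \<alpha>) y)"
    using assms(1) by (rule PhomE) blast
  have "\<exists>a. v = (\<Sum>u\<in>set us. a u *\<^sub>R u)" for v
    using span_finite[of "set us"] basis by (auto simp: vbasis_def)
  then obtain a where a: "\<And>v. v = (\<Sum>u\<in>set us. a v u *\<^sub>R u)" by metis
  \<comment> \<open>Coordinates with respect to all pairs of an exponent of degree \<open>n\<close>
    and a basis vector, zero where the exponent does not occur in \<open>f\<close>.\<close>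
  define b where "b p = (if fst p \<in> A then a (c (fst p)) (snd p) else 0)" for p
  have "f y = (\<Sum>p\<in>set (ord n). b p *\<^sub>R mono p y)" for y
  proof -
    have e: "mono (\<alpha>, v) y = (\<Sum>u\<in>set us. a v u *\<^sub>R mono (\<alpha>, u) y)" for \<alpha> v
      by (subst a[of v]) (simp add: mono_def scaleR_sum_right mult.commute)
    have "f y = (\<Sum>\<alpha>\<in>A. \<Sum>u\<in>set us. b (\<alpha>, u) *\<^sub>R mono (\<alpha>, u) y)"
      unfolding f by (intro sum.cong refl, subst e) (simp add: b_def)
    also have "\<dots> = (\<Sum>p\<in>A \<times> set us. b p *\<^sub>R mono p y)"
      by (simp add: sum.cartesian_product case_prod_unfold)
    also have "\<dots> = (\<Sum>p\<in>set (ord n). b p *\<^sub>R mono p y)"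
    proof (rule sum.mono_neutral_left[OF List.finite_set])
      show "A \<times> set us \<subseteq> set (ord n)" unfolding ord(2)[OF assms(2)] using A(2) by blast
      show "\<forall>p\<in>set (ord n) - A \<times> set us. b p *\<^sub>R mono p y = 0"
        unfolding ord(2)[OF assms(2)] by (auto simp: b_def)
    qed
    finally show ?thesis .
  qed
  then have "f = comb n (\<lambda>j. b (ord n ! j))"
    using comb_eq_sum[OF assms(2), of b "\<lambda>j. b (ord n ! j)"] by auto
  then show ?thesis by (rule that)
qed

text \<open>Taking the coefficient at the exponent of the basis element \<open>j\<close> leaves a
  linear relation among \<open>us\<close>, which is independent.\<close>

lemma comb_inj:
  assumes "comb n x = (\<lambda>y. 0)" "1 \<le> n" "j < length (ord n)"
  shows "x j = 0"
proof -
  let ?L = "length (ord n)"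
  have inj: "inj_on ((!) (ord n)) {..<?L}"
    using ord(1)[OF assms(2)] by (auto simp: inj_on_def nth_eq_iff_index_eq)
  \<comment> \<open>As the list is distinct, its coefficients can be read as a function of the basis
    elements.\<close>
  define b where "b p = x (the_inv_into {..<?L} ((!) (ord n)) p)" for p
  have b: "b (ord n ! j) = x j" if "j < ?L" for j
    using that inj by (simp add: b_def the_inv_into_f_f)
  have "ord n ! j \<in> {\<alpha>. mdeg \<alpha> = n} \<times> set us"
    unfolding ord(2)[OF assms(2), symmetric] by (rule nth_mem[OF assms(3)])
  then obtain \<alpha> u where p: "ord n ! j = (\<alpha>, u)" "mdeg \<alpha> = n" "u \<in> set us" by blast
  have fin: "finite ({\<alpha>::'n \<Rightarrow> nat. mdeg \<alpha> = n} \<times> set us)" 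
    using List.finite_set[of "ord n"] unfolding ord(2)[OF assms(2)] .
  have finM: "finite {\<alpha>::'n \<Rightarrow> nat. mdeg \<alpha> = n}"
    by (rule finite_cartesian_productD1[OF fin]) (use p(3) in auto)
  have "0 = coef \<alpha> (\<lambda>y. \<Sum>p\<in>set (ord n). b p *\<^sub>R mono p y)"
    using assms(1) comb_eq_sum[where b = b and x = x, OF assms(2) b] coef_scaleR[OF Ptau_zero, of \<alpha> 0] by simp
  also have "\<dots> = (\<Sum>p\<in>set (ord n). b p *\<^sub>R coef \<alpha> (mono p))"
    by (simp add: coef_def Dpow_sum Dpow_scaleR Ptau_scaleR mono_Ptau scaleR_sum_right mult.commute)
  also have "\<dots> = (\<Sum>\<beta> | mdeg \<beta> = n. \<Sum>u\<in>set us. b (\<beta>, u) *\<^sub>R (if \<beta> = \<alpha> then u else 0))"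
    by (simp add: ord(2)[OF assms(2)] coef_mono sum.cartesian_product case_prod_unfold)
  also have "\<dots> = (\<Sum>\<beta> | mdeg \<beta> = n. if \<beta> = \<alpha> then \<Sum>u\<in>set us. b (\<beta>, u) *\<^sub>R u else 0)"
    by (intro sum.cong refl) auto
  also have "\<dots> = (\<Sum>u\<in>set us. b (\<alpha>, u) *\<^sub>R u)"
    using finM p(2) by simp
  finally have "b (\<alpha>, u) = 0"
    using independentD[of "set us" "set us" "\<lambda>u. b (\<alpha>, u)" u] basis p(3) by (simp add: vbasis_def)
  then show ?thesis using b[OF assms(3)] p(1) by simp
qed

abbreviation G :: "nat \<Rightarrow> real \<Rightarrow> nat \<Rightarrow> nat \<Rightarrow> real" where
  "G n \<kappa> \<equiv> gram R Rp \<tau> \<kappa> ord n"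

lemma gram_eq: "G n \<kappa> j k = B \<kappa> (mono (ord n ! j)) (mono (ord n ! k))"
  by (simp add: gram_def kform_eq mono_Ptau)

lemma B_comb: "B \<kappa> (comb n x) g = (\<Sum>j<length (ord n). x j * B \<kappa> (mono (ord n ! j)) g)"
  by (simp add: comb_def B_sum_left B_scaleR_left Ptau_scaleR mono_Ptau)

lemma B_comb_mono: "B \<kappa> (comb n x) (mono (ord n ! k)) = (\<Sum>j<length (ord n). x j * G n \<kappa> j k)"
  by (simp add: B_comb gram_eq)

lemma B_comb_comb: "B \<kappa> (comb n x) (comb n y) = qform (length (ord n)) (G n \<kappa>) x y"
  by (simp add: B_comb comb_def[of n y] B_sum_right B_scaleR_right Ptau_scaleR mono_Ptau gram_eq
      qform_def sum_distrib_left mult.assoc)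

lemma gram_sym: "G n \<kappa> j k = G n \<kappa> k j"
  by (simp add: gram_eq B_sym mono_Ptau)

lemma continuous_gram: "continuous_on UNIV (\<lambda>\<kappa>. G n \<kappa> j k)"
  by (simp add: gram_eq continuous_B mono_Ptau)

lemma comb_nonzero:
  assumes "1 \<le> n" "f \<in> Phom n" "f \<noteq> (\<lambda>x. 0)"
  obtains x j where "f = comb n x" "j < length (ord n)" "x j \<noteq> 0"
proof -
  obtain x where x: "f = comb n x" using comb_surj[OF assms(2,1)] by blast
  have "\<exists>j<length (ord n). x j \<noteq> 0"
  proof (rule ccontr)
    assume "\<not> (\<exists>j<length (ord n). x j \<noteq> 0)"
    then have "comb n x = (\<lambda>y. 0)" by (simp add: comb_def)
    with x assms(3) show False by simp
  qed
  with x that show ?thesis by blast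
qed

text \<open>The kernel vectors of the symmetric Gram matrix are the coordinate vectors of the
  radical.\<close>

lemma degenerate_iff_minor:
  assumes "1 \<le> n"
  shows "degenerate \<kappa> n \<longleftrightarrow> lead_minor (G n \<kappa>) (length (ord n)) = 0"
proof -
  let ?L = "length (ord n)"
  have sum: "(\<Sum>j<?L. G n \<kappa> i j * x j) = B \<kappa> (comb n x) (mono (ord n ! i))" for i x
    unfolding B_comb_mono by (simp add: gram_sym[of _ _ i] mult.commute)
  show ?thesis
  proof
    assume "degenerate \<kappa> n"
    then obtain f where f: "f \<in> Phom n" "f \<noteq> (\<lambda>x. 0)" "\<And>g. g \<in> Phom n \<Longrightarrow> B \<kappa> f g = 0"
      by (auto simp: degenerate_def)
    obtain x j where x: "f = comb n x" "j < ?L" "x j \<noteq> 0"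
      using comb_nonzero[OF assms f(1,2)] by blast
    have "\<forall>i<?L. (\<Sum>j<?L. G n \<kappa> i j * x j) = 0"
      unfolding sum using f(3) x(1) mono_ord_Phom[OF assms] by simp
    then show "lead_minor (G n \<kappa>) ?L = 0"
      using x(2,3) unfolding lead_minor_eq_0_iff by blast
  next
    assume "lead_minor (G n \<kappa>) ?L = 0"
    then obtain x where x: "\<exists>i<?L. x i \<noteq> 0" "\<And>i. i < ?L \<Longrightarrow> B \<kappa> (comb n x) (mono (ord n ! i)) = 0"
      unfolding lead_minor_eq_0_iff sum by blast
    have "B \<kappa> (comb n x) g = 0" if g: "g \<in> Phom n" for g
    proof -
      obtain y where y: "g = comb n y" using comb_surj[OF g assms] by blast
      show ?thesis unfolding y comb_def[of n y]
        by (simp add: B_sum_right B_scaleR_right Ptau_scaleR mono_Ptau x(2))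
    qed
    moreover have "comb n x \<noteq> (\<lambda>x. 0)" using comb_inj[OF _ assms] x(1) by blast
    ultimately show "degenerate \<kappa> n"
      unfolding degenerate_def using comb_Phom[OF assms] by blast
  qed
qed

text \<open>A kernel vector of the corner, padded with zeros, would be a nonzero vector on which the
  form vanishes.\<close>

lemma posdef_minor_nonzero:
  assumes "1 \<le> n" "posdef \<kappa> n" "m \<le> length (ord n)"
  shows "lead_minor (G n \<kappa>) m \<noteq> 0"
proof
  let ?L = "length (ord n)"
  assume "lead_minor (G n \<kappa>) m = 0"
  then obtain x where x: "\<exists>i<m. x i \<noteq> 0" "\<And>i. i < m \<Longrightarrow> (\<Sum>j<m. G n \<kappa> i j * x j) = 0"
    unfolding lead_minor_eq_0_iff by blast
  define y where "y i = (if i < m then x i else 0)" for i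
  have restrict: "(\<Sum>j<?L. y j * h j) = (\<Sum>j<m. x j * h j)" for h
    by (rule sum.mono_neutral_cong_right) (use assms(3) in \<open>auto simp: y_def\<close>)
  have "B \<kappa> (comb n y) (comb n y) = (\<Sum>k<?L. y k * (\<Sum>j<?L. y j * G n \<kappa> j k))"
    by (simp add: B_comb_comb qform_eq)
  also have "\<dots> = (\<Sum>k<m. x k * (\<Sum>j<m. G n \<kappa> k j * x j))"
    unfolding restrict by (simp add: gram_sym mult.commute)
  also have "\<dots> = 0" by (simp add: x(2))
  finally have "comb n y = (\<lambda>x. 0)"
    using assms(2) comb_Phom[OF assms(1), of y] by (auto simp: posdef_def)
  moreover obtain i where "i < m" "x i \<noteq> 0" using x(1) by blast
  ultimately show False
    using comb_inj[of n y i] assms(1,3) by (simp add: y_def)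
qed

text \<open>The Gram matrices form a continuous path of symmetric matrices that starts positive
  definite at \<open>0\<close> and stays nonsingular up to \<open>\<kappa>\<close>.\<close>

lemma posdef_until_degenerate:
  assumes n: "1 \<le> n" and \<kappa>: "0 \<le> \<kappa>" and nd: "\<And>\<mu>. 0 < \<mu> \<Longrightarrow> \<mu> \<le> \<kappa> \<Longrightarrow> \<not> degenerate \<mu> n"
  shows "posdef \<kappa> n"
  unfolding posdef_def
proof (intro ballI impI)
  let ?L = "length (ord n)"
  fix f :: "real^'n \<Rightarrow> 'v" assume f: "f \<in> Phom n" "f \<noteq> (\<lambda>x. 0)"
  obtain x j where x: "f = comb n x" "j < ?L" "x j \<noteq> 0"
    using comb_nonzero[OF n f] by blast
  have "qform ?L (G n \<kappa>) x x > 0"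
  proof (rule pos_def_along_path[where M = "G n" and i = j])
    fix y i assume i: "i < ?L" "y i \<noteq> (0::real)"
    have "comb n y \<noteq> (\<lambda>x. 0)" using comb_inj[OF _ n i(1), of y] i(2) by blast
    then show "qform ?L (G n 0) y y > 0"
      using posdef_at_0[of n] comb_Phom[OF n, of y] by (simp add: posdef_def flip: B_comb_comb)
  next
    fix \<mu> y i assume \<mu>: "0 < \<mu>" "\<mu> \<le> \<kappa>" and i: "i < ?L" "y i \<noteq> (0::real)"
    have "lead_minor (G n \<mu>) ?L \<noteq> 0" using nd[OF \<mu>] degenerate_iff_minor[OF n] by blast
    then have "\<exists>k<?L. (\<Sum>j<?L. G n \<mu> k j * y j) \<noteq> 0"
      using i unfolding lead_minor_eq_0_iff by blast
    then show "\<exists>k<?L. (\<Sum>j<?L. y j * G n \<mu> j k) \<noteq> 0"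
      by (simp add: gram_sym mult.commute)
  qed (use \<kappa> x continuous_gram gram_sym in auto)
  then show "B \<kappa> f f > 0" by (simp add: x(1) B_comb_comb)
qed

text \<open>The first zero of any leading minor is already a zero of the full Gram determinant, because the
  form stays positive definite up to the first parameter at which it degenerates.\<close>

lemma zval_cases:
  assumes n: "1 \<le> n"
  obtains (inf) "zval R Rp \<tau> ord n = \<infinity>" "\<And>\<kappa>. 0 < \<kappa> \<Longrightarrow> \<not> degenerate \<kappa> n"
  | (fin) s where "0 < s" "zval R Rp \<tau> ord n = ereal s" "degenerate s n"
      "\<And>\<kappa>. 0 < \<kappa> \<Longrightarrow> \<kappa> < s \<Longrightarrow> \<not> degenerate \<kappa> n"
proof -
  let ?L = "length (ord n)"
  define Z where "Z = {\<kappa>. 0 < \<kappa> \<and> (\<exists>m\<in>{1..?L}. lead_minor (G n \<kappa>) m = 0)}"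
  define S where "S = {\<kappa>. 0 < \<kappa> \<and> degenerate \<kappa> n}"
  have zval: "zval R Rp \<tau> ord n = (INF \<kappa>\<in>Z. ereal \<kappa>)"
    by (simp add: zval_def Z_def)
  \<comment> \<open>Without a degenerate parameter up to \<open>\<kappa>\<close> the form is
    positive definite at \<open>\<kappa>\<close>, and then no leading minor vanishes.\<close>
  have before: "\<exists>\<mu>\<in>S. \<mu> \<le> \<kappa>" if "\<kappa> \<in> Z" for \<kappa>
  proof (rule ccontr)
    assume "\<not> (\<exists>\<mu>\<in>S. \<mu> \<le> \<kappa>)"
    then have "posdef \<kappa> n"
      using that by (intro posdef_until_degenerate n) (auto simp: S_def Z_def)
    then show False using that posdef_minor_nonzero[OF n] by (auto simp: Z_def)
  qed
  show ?thesis
  proof (cases "S = {}")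
    case True
    then have "Z = {}" using before by auto
    then have "zval R Rp \<tau> ord n = \<infinity>" by (simp add: zval top_ereal_def)
    with True inf show ?thesis by (auto simp: S_def)
  next
    case False
    \<comment> \<open>Since \<open>0\<close> is not degenerate, the strict bound can be relaxed;
      this makes \<open>S\<close> closed, so its infimum is attained.\<close>
    have "S = {\<kappa>. 0 \<le> \<kappa> \<and> lead_minor (G n \<kappa>) ?L = 0}"
      using posdef_not_degenerate[OF posdef_at_0[of n]]
      by (auto simp: S_def degenerate_iff_minor[OF n] less_le)
    moreover have "continuous_on UNIV (\<lambda>\<kappa>. lead_minor (G n \<kappa>) ?L)"
      unfolding lead_minor_def by (intro continuous_intros continuous_gram)
    then have "closed {\<kappa>. 0 \<le> \<kappa> \<and> lead_minor (G n \<kappa>) ?L = 0}"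
      by (intro closed_Collect_conj closed_Collect_le closed_Collect_eq continuous_intros)
    ultimately have "closed S" by simp
    moreover have bdd: "bdd_below S" by (rule bdd_belowI[of _ 0]) (simp add: S_def)
    ultimately have s: "Inf S \<in> S" using False by (intro closed_contains_Inf)
    have least: "Inf S \<le> \<mu>" if "\<mu> \<in> S" for \<mu> using that bdd by (rule cInf_lower)
    have "Inf S \<in> Z"
    proof -
      have "lead_minor (G n (Inf S)) ?L = 0" using s degenerate_iff_minor[OF n] by (simp add: S_def)
      \<comment> \<open>The empty minor is \<open>1\<close>, so a vanishing full determinant has
        positive size and is among the minors in \<open>zval\<close>.\<close>
      moreover from this have "1 \<le> ?L" unfolding lead_minor_eq_0_iff by (cases ?L) auto
      ultimately show ?thesis using s by (auto simp: Z_def S_def)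
    qed
    moreover have "Inf S \<le> \<kappa>" if "\<kappa> \<in> Z" for \<kappa>
      using before[OF that] least by force
    ultimately have "zval R Rp \<tau> ord n = ereal (Inf S)"
      unfolding zval by (intro antisym INF_lower INF_greatest) auto
    then show ?thesis
      using s least fin[of "Inf S"] by (force simp: S_def)
  qed
qed

lemma zval_le_degenerate:
  assumes "1 \<le> n" "0 < \<kappa>"
  shows "degenerate \<kappa> n \<Longrightarrow> zval R Rp \<tau> ord n \<le> ereal \<kappa>"
  using assms(1)
proof (cases rule: zval_cases)
  case (fin s)
  assume "degenerate \<kappa> n"
  then show ?thesis using fin assms(2) by (metis ereal_less_eq(3) not_le)
qed (use assms(2) in auto)

lemma posdef_below_zval:
  assumes "0 \<le> \<kappa>" "n = 0 \<or> ereal \<kappa> < zval R Rp \<tau> ord n"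
  shows "posdef \<kappa> n"
proof (cases "n = 0")
  case False
  then have n: "1 \<le> n" by simp
  have lt: "ereal \<kappa> < zval R Rp \<tau> ord n" using assms(2) False by simp
  show ?thesis
  proof (rule posdef_until_degenerate[OF n assms(1)])
    fix \<mu> assume \<mu>: "0 < \<mu>" "\<mu> \<le> \<kappa>"
    show "\<not> degenerate \<mu> n"
    proof
      assume "degenerate \<mu> n"
      then have "zval R Rp \<tau> ord n \<le> ereal \<mu>" by (rule zval_le_degenerate[OF n \<mu>(1)])
      also have "\<dots> \<le> ereal \<kappa>" using \<mu>(2) by simp
      finally show False using lt by simp
    qed
  qed
qed (simp add: posdef_degree_0)

text \<open>Degeneracy passes to the next degree, so the first degenerate parameter cannot
  increase.\<close>

lemma zval_Suc:
  assumes n: "1 \<le> n"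
  shows "zval R Rp \<tau> ord (Suc n) \<le> zval R Rp \<tau> ord n"
  using n
proof (cases rule: zval_cases)
  case (fin s)
  then show ?thesis
    using zval_le_degenerate[OF _ fin(1), of "Suc n"] degenerate_Suc[OF fin(3)] by simp
qed simp

lemma zval_antimono:
  assumes "1 \<le> m" "m \<le> n"
  shows "zval R Rp \<tau> ord n \<le> zval R Rp \<tau> ord m"
  using assms(2)
proof (induction rule: dec_induct)
  case (step k)
  then show ?case using zval_Suc[of k] assms(1) by (meson order_trans)
qed simp

text \<open>At the parameter of the drop, degree \<open>n - 1\<close> is still positive definite.
  For \<open>n = 1\<close> that degree consists of constants, where the form is always definite;
  \<open>ord 0\<close> is arbitrary, so its \<open>zval\<close> is not consulted.\<close>

lemma zval_jump_singular:
  assumes n: "1 \<le> n" "zval R Rp \<tau> ord n < \<infinity>"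
    and jump: "n = 1 \<or> zval R Rp \<tau> ord n < zval R Rp \<tau> ord (n - 1)"
  obtains \<kappa> f where "0 < \<kappa>" "zval R Rp \<tau> ord n = ereal \<kappa>" "f \<in> Phom n" "f \<noteq> (\<lambda>x. 0)"
    "\<And>i. D \<kappa> i f = (\<lambda>x. 0)"
  using n(1)
proof (cases rule: zval_cases)
  case (fin \<kappa>)
  have n': "n = Suc (n - 1)" using n(1) by simp
  have "posdef \<kappa> (n - 1)"
    using jump fin(1,2) by (intro posdef_below_zval) auto
  then obtain f where "f \<in> Phom n" "f \<noteq> (\<lambda>x. 0)" "\<And>i. D \<kappa> i f = (\<lambda>x. 0)"
    using degenerate_singular[of \<kappa> "n - 1"] fin(3) n' by metis
  with fin that show ?thesis by blast
qed (use n in simp)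

text \<open>Homogeneous components are mutually orthogonal, so \<open>B \<kappa> f f\<close> is the
  sum of the values at the components.\<close>

lemma B_pos:
  assumes "\<And>n. posdef \<kappa> n" "f \<in> Ptau" "f \<noteq> (\<lambda>x. 0)"
  shows "B \<kappa> f f > 0"
proof -
  obtain d h where h: "\<And>n. h n \<in> Phom n" and f: "f = (\<lambda>x. \<Sum>n<d. h n x)"
    using assms(2) by (rule Ptau_sum_Phom) blast
  have hP: "h n \<in> Ptau" for n by (rule Phom_Ptau[OF h])
  have "B \<kappa> f f = (\<Sum>m<d. \<Sum>n<d. B \<kappa> (h m) (h n))"
    by (simp add: f B_sum_left B_sum_right hP)
  also have "\<dots> = (\<Sum>m<d. \<Sum>n<d. if n = m then B \<kappa> (h m) (h m) else 0)"
    by (intro sum.cong refl) (auto intro: B_orthogonal[OF h h])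
  also have "\<dots> = (\<Sum>m<d. B \<kappa> (h m) (h m))" by (intro sum.cong refl) simp
  also have "\<dots> > 0"
  proof -
    have "\<exists>m<d. h m \<noteq> (\<lambda>x. 0)"
    proof (rule ccontr)
      assume "\<not> (\<exists>m<d. h m \<noteq> (\<lambda>x. 0))"
      then have "f = (\<lambda>x. 0)" unfolding f by (intro ext sum.neutral) simp
      with assms(3) show False by simp
    qed
    then obtain m where m: "m < d" "h m \<noteq> (\<lambda>x. 0)" by blast
    have "B \<kappa> (h k) (h k) \<ge> 0" for k
      using assms(1)[of k] h[of k]
      by (cases "h k = (\<lambda>x. 0)") (auto simp: posdef_def B_zero_left less_imp_le)
    moreover have "B \<kappa> (h m) (h m) > 0" using assms(1)[of m] h[of m] m(2) by (simp add: posdef_def)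
    ultimately show ?thesis using m(1) by (intro sum_pos2[of _ m]) auto
  qed
  finally show ?thesis .
qed

end

section \<open>The sequence of degrees where \<open>z\<close> drops\<close>

lemma nseq_jump:
  assumes ex: "\<exists>n\<ge>1. z n < \<infinity>" and "nseq z i = Some n"
  shows "1 \<le> n \<and> z n < \<infinity> \<and> (n = 1 \<or> z n < z (n - 1))"
proof (cases i)
  case 0
  then have n: "n = (LEAST n. 1 \<le> n \<and> z n < \<infinity>)" using assms(2) by simp
  have 1: "1 \<le> n \<and> z n < \<infinity>" unfolding n using ex by (rule LeastI_ex[of "\<lambda>n. 1 \<le> n \<and> z n < \<infinity>"])
  \<comment> \<open>By minimality the first index is a drop from infinity, unless it is
    \<open>1\<close>, whose predecessor \<open>0\<close> is outside the range considered.\<close>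
  moreover have "z (n - 1) = \<infinity>" if "n \<noteq> 1"
  proof -
    have "\<not> (1 \<le> n - 1 \<and> z (n - 1) < \<infinity>)"
      by (rule not_less_Least) (unfold n[symmetric], use 1 in simp)
    then show ?thesis using 1 that by auto
  qed
  ultimately show ?thesis by force
next
  case (Suc j)
  then obtain m where m: "\<exists>n. m < n \<and> z n < z (n - 1)"
      "n = (LEAST n. m < n \<and> z n < z (n - 1))"
    using assms(2) by (auto split: option.splits if_splits)
  have "m < n \<and> z n < z (n - 1)"
    unfolding m(2) using m(1) by (rule LeastI_ex[of "\<lambda>n. m < n \<and> z n < z (n - 1)"])
  then show ?thesis by auto
qed

text \<open>If the drop \<open>n\<close> were skipped, no term could pass it, since each next term
  is the least drop beyond the last. The sequence would never stop and stay below \<open>n\<close>,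
  yet its term number \<open>i\<close> is at least \<open>i\<close>.\<close>

lemma nseq_complete:
  assumes ex: "\<exists>n\<ge>1. z n < \<infinity>" and n: "1 \<le> n" "z n < \<infinity>" "n = 1 \<or> z n < z (n - 1)"
  shows "\<exists>i. nseq z i = Some n"
proof (rule ccontr)
  assume not: "\<nexists>i. nseq z i = Some n"
  have "\<exists>m. nseq z i = Some m \<and> i \<le> m \<and> m < n" for i
  proof (induction i)
    case 0
    let ?m = "LEAST n. 1 \<le> n \<and> z n < \<infinity>"
    have "?m \<le> n" by (rule Least_le) (use n in simp)
    moreover have "nseq z 0 = Some ?m" by simp
    ultimately show ?case using not by (metis le0 le_neq_implies_less)
  next
    case (Suc i)
    then obtain m where m: "nseq z i = Some m" "i \<le> m" "m < n" by blast
    let ?P = "\<lambda>n. m < n \<and> z n < z (n - 1)"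
    have "n \<noteq> 1" using nseq_jump[OF ex m(1)] m(3) by auto
    then have P: "?P n" using n m(3) by simp
    have 1: "nseq z (Suc i) = Some (Least ?P)" using m(1) P by auto
    have "Least ?P \<le> n" "m < Least ?P" using P by (rule Least_le) (use LeastI[of ?P, OF P] in simp)
    then show ?case using 1 not m(2) by (metis Suc_leI le_less_trans le_neq_implies_less)
  qed
  from this[of n] show False by auto
qed

text \<open>Going down from \<open>n\<close> while the value stays the same leads to a drop or to
  index \<open>1\<close>.\<close>

lemma antimono_jump:
  fixes z :: "nat \<Rightarrow> ereal"
  assumes "1 \<le> n" "z n < \<infinity>" "\<And>m. 1 \<le> m \<Longrightarrow> z (Suc m) \<le> z m"
  shows "\<exists>m. 1 \<le> m \<and> z m = z n \<and> (m = 1 \<or> z m < z (m - 1))"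
  using assms(1,2)
proof (induction n rule: dec_induct)
  case (step n)
  show ?case
  proof (cases "z (Suc n) < z n")
    case False
    then have "z (Suc n) = z n" using assms(3)[of n] step.hyps by (simp add: antisym)
    then show ?thesis using step by simp
  qed (use step in \<open>auto intro: exI[of _ "Suc n"]\<close>)
qed auto

theorem theorem2p7:
  fixes R Rp :: "(real^'n::finite) set"
    and \<tau> :: "real^'n^'n \<Rightarrow> 'v::euclidean_space \<Rightarrow> 'v"
    and us :: "'v list"
    and ord :: "nat \<Rightarrow> (('n \<Rightarrow> nat) \<times> 'v) list"
  assumes "reduced_root_system R"
    and "positive_roots R Rp"
    and "single_refl_class R"
    and "orth_irrep R \<tau>"
    and "vbasis us"
    and "\<forall>n\<ge>1. distinct (ord n) \<and> set (ord n) = {\<alpha>. mdeg \<alpha> = n} \<times> set us"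
    and "\<exists>n\<ge>1. zval R Rp \<tau> ord n < \<infinity>"
  defines "z \<equiv> zval R Rp \<tau> ord"
  defines "z0 \<equiv> (INF n \<in> {n. \<exists>i. nseq z i = Some n}. z n)"
  shows "(\<exists>j n. nseq z j = Some n \<and> z0 = z n)
     \<and> (\<forall>\<kappa>. 0 \<le> \<kappa> \<and> ereal \<kappa> < z0 \<longrightarrow>
           (\<forall>f\<in>Ptau. f \<noteq> (\<lambda>x. 0) \<longrightarrow> kform R Rp \<tau> \<kappa> f f > 0))
     \<and> (\<exists>\<kappa>0. z0 = ereal \<kappa>0 \<and> singular_value Rp \<tau> \<kappa>0 TYPE('n) TYPE('v))"
proof -
  interpret dunkl_basis R Rp \<tau> us ord
    by unfold_locales (use assms in auto)
  define J where "J = {n. \<exists>i. nseq z i = Some n}"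
  have ex: "\<exists>n\<ge>1. z n < \<infinity>" using assms(7) by (simp add: z_def)
  have jump: "1 \<le> n \<and> z n < \<infinity> \<and> (n = 1 \<or> z n < z (n - 1))" if "n \<in> J" for n
    using nseq_jump[OF ex] that by (auto simp: J_def)
  have sing: "\<exists>\<kappa> f. 0 < \<kappa> \<and> z n = ereal \<kappa> \<and> f \<in> Phom n \<and> f \<noteq> (\<lambda>x. 0) \<and> (\<forall>i. D \<kappa> i f = (\<lambda>x. 0))"
    if "n \<in> J" for n
    using zval_jump_singular[of n] jump[OF that] unfolding z_def by metis
  obtain n1 where n1: "nseq z 0 = Some n1" "n1 = (LEAST n. 1 \<le> n \<and> z n < \<infinity>)" by simp
  have n1J: "n1 \<in> J" unfolding J_def using n1(1) by blast
  obtain \<kappa>1 where \<kappa>1: "z n1 = ereal \<kappa>1" using sing[OF n1J] by blast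
  \<comment> \<open>A drop at \<open>n\<close> yields a singular polynomial of degree
    \<open>n\<close>. Its parameter is at most \<open>\<kappa>1\<close>, the value at the first
    drop, so the degree bound is uniform and \<open>J\<close> is finite.\<close>
  have "real n \<le> 2 * \<kappa>1 * real (card Rp)" if nJ: "n \<in> J" for n
  proof -
    obtain \<kappa> f where \<kappa>: "0 < \<kappa>" "z n = ereal \<kappa>" "f \<in> Phom n" "f \<noteq> (\<lambda>x. 0)" "\<And>i. D \<kappa> i f = (\<lambda>x. 0)"
      using sing[OF nJ] by blast
    have "n1 \<le> n" unfolding n1(2) using jump[OF nJ] by (intro Least_le) blast
    then have "z n \<le> z n1" unfolding z_def using jump[OF n1J] by (intro zval_antimono) auto
    then have "\<kappa> \<le> \<kappa>1" by (simp add: \<kappa>(2) \<kappa>1)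
    have "real n \<le> 2 * \<bar>\<kappa>\<bar> * real (card Rp)" by (rule singular_degree_bound[OF \<kappa>(3-5)])
    also have "\<dots> \<le> 2 * \<kappa>1 * real (card Rp)"
      using \<kappa>(1) \<open>\<kappa> \<le> \<kappa>1\<close> by (intro mult_right_mono) auto
    finally show ?thesis .
  qed
  then have "J \<subseteq> {..nat \<lfloor>2 * \<kappa>1 * real (card Rp)\<rfloor>}"
    by (auto simp: le_nat_floor)
  then have finJ: "finite J" using finite_subset by blast
  have z0: "z0 = (INF n\<in>J. z n)" by (simp add: z0_def J_def)
  have "z0 = Min (z ` J)" unfolding z0 by (rule Min_Inf[symmetric]) (use finJ n1J in auto)
  then have "z0 \<in> z ` J" using Min_in[of "z ` J"] finJ n1J by blast
  then obtain m where m: "m \<in> J" "z0 = z m" by blast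
  obtain j where j: "nseq z j = Some m" using m(1) by (auto simp: J_def)
  \<comment> \<open>Every finite value of \<open>z\<close> from index \<open>1\<close> on is already
    taken at a drop, so the infimum over \<open>J\<close> bounds all degrees.\<close>
  have z0_le: "z0 \<le> z n" if "1 \<le> n" for n
  proof (cases "z n < \<infinity>")
    case True
    have "z (Suc k) \<le> z k" if "1 \<le> k" for k
      unfolding z_def using that by (rule zval_Suc)
    from antimono_jump[of n z, OF \<open>1 \<le> n\<close> True this] obtain k where
      k: "1 \<le> k" "z k = z n" "k = 1 \<or> z k < z (k - 1)" by blast
    then have "k \<in> J" using nseq_complete[OF ex] True by (simp add: J_def)
    then show ?thesis unfolding z0 k(2)[symmetric] by (rule INF_lower)
  qed simp
  have pos: "kform R Rp \<tau> \<kappa> f f > 0"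
    if \<kappa>: "0 \<le> \<kappa>" "ereal \<kappa> < z0" and f: "f \<in> Ptau" "f \<noteq> (\<lambda>x. 0)" for \<kappa> f
  proof -
    have "posdef \<kappa> n" for n
      using z0_le[of n] \<kappa> by (intro posdef_below_zval) (auto simp: z_def intro: less_le_trans)
    then show ?thesis using f by (simp add: kform_eq B_pos)
  qed
  obtain \<kappa> f where \<kappa>: "z m = ereal \<kappa>" and f: "f \<in> Phom m" "f \<noteq> (\<lambda>x. 0)" "\<And>i. D \<kappa> i f = (\<lambda>x. 0)"
    using sing[OF m(1)] by blast
  \<comment> \<open>A homogeneous polynomial of positive degree vanishes at the origin, so it could
    only be constant by being zero.\<close>
  have "\<nexists>u. f = (\<lambda>x. u)"
  proof
    assume "\<exists>u. f = (\<lambda>x. u)"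
    then obtain u where u: "f = (\<lambda>x. u)" by blast
    have "u = f 0" by (simp add: u)
    also have "f 0 = 0" using Phom_at_0[OF f(1)] jump[OF m(1)] by simp
    finally show False using u f(2) by simp
  qed
  then have "singular_value Rp \<tau> \<kappa> TYPE('n) TYPE('v)"
    unfolding singular_value_def using Phom_Ptau[OF f(1)] f(3) by blast
  then show ?thesis using j m(2) \<kappa> pos by metis
qed

end
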